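(* Let $\mathfrak G=(G_2\xrightarrow{\partial}G_1)$ be a $\mathbb Z_2$-graded crossed module and $(A,\omega)$ an N-weak $\mathfrak G$-algebra over a field $\mathbb K$. Then there exist a $\mathbb Z_2$-graded crossed module $\mathfrak H$, a strict homomorphism of $\mathbb Z_2$-graded crossed modules $\varphi:\mathfrak H\to\mathfrak G$ and a strict $\mathfrak H$-algebra structure $\psi:\mathfrak H\to\mathrm{AUT}^{\mathrm{gen}}(A)$ on the algebra $A$ such that (i) the induced homomorphism of $2$-groups $\widetilde\varphi:\widetilde{\mathfrak H}\to\widetilde{\mathfrak G}$ is an equivalence, and (ii) the N-weak $\mathfrak H$-algebra $(A,\omega\varphi)$ and the strict $\mathfrak H$-algebra $(A,\psi)$ are $\mathfrak H$-Morita equivalent.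
   Context: Crossed modules. A crossed module $\mathfrak G=(G_2\xrightarrow{\partial}G_1)$ consists of groups $G_1,G_2$, an action $(g,x)\mapsto{}^gx$ of $G_1$ on $G_2$ by automorphisms and a homomorphism $\partial$ with $\partial({}^gx)=g\partial(x)g^{-1}$, ${}^{\partial(y)}x=yxy^{-1}$. With $\mathbb Z_2=\{\pm1\}$, a $\mathbb Z_2$-grading is a homomorphism $\pi:G_1\to\mathbb Z_2$ (possibly trivial) with $\operatorname{im}\partial\le\ker\pi$; strict homomorphisms are pairs of group homomorphisms compatible with $\partial$, the actions and the gradings. The $2$-group $\widetilde{\mathfrak G}$ has one object, $1$-morphisms $G_1$, $2$-morphisms $x:g\Rightarrow\partial(x)g$ ($x\in G_2$), vertical composition $x_2x_1$, horizontal composition of $x:g_1\Rightarrow g_2$ with $x':g_1'\Rightarrow g_2'$ equal to $x\cdot{}^{g_1}x'$. N-weak algebras. Algebras are associative unital $\mathbb K$-algebras; ${}^{+1}A=A$, ${}^{-1}A=A^{\mathrm{op}}$. $\mathrm{Aut}^{\mathrm{gen}}(A)$ is the group of all algebra isomorphisms $A\to A$ (degree $+1$) and $A^{\mathrm{op}}\to A$ (degree $-1$) under composition. $\mathrm{AUT}^{\mathrm{gen}}(A)=(A^\times\xrightarrow{\partial}\mathrm{Aut}^{\mathrm{gen}}(A))$ is the $\mathbb Z_2$-graded crossed module with ${}^gy=g(y^{\pi(g)})$ and $\partial(y)(a)=yay^{-1}$. An N-weak $\mathfrak G$-algebra is an algebra $A$ with maps $\omega_3:G_1\times G_1\to A^\times$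 (equal to $1$ if one argument is $e$), $\omega_1:G_1\to\mathrm{Aut}^{\mathrm{gen}}(A)$ degree preserving and unital, $\omega_2:G_2\to A^\times$ unital, such that $\omega_1(g_2g_1)=\partial(\omega_3(g_2,g_1))\omega_1(g_2)\omega_1(g_1)$; $\omega_2(x_2x_1)=\omega_3(\partial x_2,\partial x_1)\omega_2(x_2)\omega_2(x_1)$; $\omega_1\circ\partial=\partial\circ\omega_2$; $\omega_3(g_3g_2,g_1)\omega_3(g_3,g_2)=\omega_3(g_3,g_2g_1)\cdot{}^{\omega_1(g_3)}\omega_3(g_2,g_1)$; $\omega_2({}^gx)=\omega_3(g\partial x,g^{-1})\,\omega_3(g,\partial x)\cdot{}^{\omega_1(g)}\omega_2(x)\,\omega_3(g,g^{-1})^{-1}$. It is strict if $\omega_3\equiv1$, i.e. $(\omega_1,\omega_2)$ is a strict homomorphism of graded crossed modules to $\mathrm{AUT}^{\mathrm{gen}}(A)$. $(A,\omega\varphi)$ denotes the pullback of the structure along $\varphi$. Morita equivalence. For a $B$-$A$-bimodule $M$ put $M^\circ=\mathrm{Hom}_{\mathrm{Mod}\text{-}A}(M,A)$, viewed as a $B^{\mathrm{op}}$-$A^{\mathrm{op}}$-bimodule; ${}^{+1}M=M$, ${}^{-1}M=M^\circ$; $\mathrm{ev}_M:M\to M^{\circ\circ}$ is evaluation. For N-weak $\mathfrak H$-algebras $A,B$ ($\mathfrak H=(H_2\to H_1)$), a $1$-morphism $(M,\omega_M):A\to B$ is a $B$-$A$-bimodule $M$ with $\mathbb K$-linear isomorphisms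 $\omega_M(g):{}^{\pi(g)}M\to M$ ($g\in H_1$), $\omega_M(e)=\mathrm{id}$, such that (a) $\omega_M(g)(bma)=\omega_{B,1}(g)(b)\,\omega_M(g)(m)\,\omega_{A,1}(g)(a)$ for $a\in{}^{\pi(g)}A$, $m\in{}^{\pi(g)}M$, $b\in{}^{\pi(g)}B$; (b) $\omega_M(g_2g_1)(m)=\omega_{B,3}(g_2,g_1)\cdot\omega_M(g_2)\big(\omega_M(g_1)^{[g_2]}(m)\big)\cdot\omega_{A,3}(g_2,g_1)^{-1}$, where $\omega_M(g_1)^{[g_2]}=\omega_M(g_1)$ if $\pi(g_2)=1$, and if $\pi(g_2)=-1$ it is $({}^{\pi(g_1)}M)^\circ\to M^\circ$, $\mathfrak m\mapsto\omega_{A,1}(g_1)\circ\mathfrak m\circ\omega_M(g_1)^{-1}$, precomposed with $\mathrm{ev}_M$ when also $\pi(g_1)=-1$; (c) $\omega_M(\partial x)(m)=\omega_{B,2}(x)\,m\,\omega_{A,2}(x)^{-1}$ for $x\in H_2$. $A$ and $B$ are $\mathfrak H$-Morita equivalent if there is such a $1$-morphism with $M$ an invertible bimodule; for separable algebras this is equivalence in the bicategory of separable N-weak $\mathfrak H$-algebras. *)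

theory Defs
  imports "HOL-Algebra.Algebra"
begin

section \<open>Graded crossed modules\<close>

text \<open>\<open>grading\<close> takes values in \<^const>\<open>sign_img\<close>, the multiplicative group \<open>{1, -1}\<close> of integers.\<close>

record ('g, 'x) crossed_module =
  grp1 :: "'g monoid"
  grp2 :: "'x monoid"
  bd :: "'x \<Rightarrow> 'g"
  act :: "'g \<Rightarrow> 'x \<Rightarrow> 'x"
  grading :: "'g \<Rightarrow> int"

locale graded_crossed_module =
  fixes G :: "('g, 'x) crossed_module"
  assumes group1: "group (grp1 G)"
    and group2: "group (grp2 G)"
    and bd_hom: "bd G \<in> hom (grp2 G) (grp1 G)"
    and act_hom: "g \<in> carrier (grp1 G) \<Longrightarrow> act G g \<in> hom (grp2 G) (grp2 G)"
    and act_one: "x \<in> carrier (grp2 G) \<Longrightarrow> act G \<one>\<^bsub>grp1 G\<^esub> x = x"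
    and act_mult: "\<lbrakk>g \<in> carrier (grp1 G); h \<in> carrier (grp1 G); x \<in> carrier (grp2 G)\<rbrakk> \<Longrightarrow>
      act G (g \<otimes>\<^bsub>grp1 G\<^esub> h) x = act G g (act G h x)"
    and equivariance: "\<lbrakk>g \<in> carrier (grp1 G); x \<in> carrier (grp2 G)\<rbrakk> \<Longrightarrow>
      bd G (act G g x) = g \<otimes>\<^bsub>grp1 G\<^esub> bd G x \<otimes>\<^bsub>grp1 G\<^esub> inv\<^bsub>grp1 G\<^esub> g"
    and peiffer: "\<lbrakk>x \<in> carrier (grp2 G); y \<in> carrier (grp2 G)\<rbrakk> \<Longrightarrow>
      act G (bd G y) x = y \<otimes>\<^bsub>grp2 G\<^esub> x \<otimes>\<^bsub>grp2 G\<^esub> inv\<^bsub>grp2 G\<^esub> y"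
    and grading_hom: "grading G \<in> hom (grp1 G) sign_img"
    and grading_bd: "x \<in> carrier (grp2 G) \<Longrightarrow> grading G (bd G x) = 1"

definition strict_hom ::
  "('h, 'y) crossed_module \<Rightarrow> ('g, 'x) crossed_module \<Rightarrow> ('h \<Rightarrow> 'g) \<Rightarrow> ('y \<Rightarrow> 'x) \<Rightarrow> bool"
where
  "strict_hom H G \<phi>1 \<phi>2 \<longleftrightarrow>
     \<phi>1 \<in> hom (grp1 H) (grp1 G) \<and> \<phi>2 \<in> hom (grp2 H) (grp2 G) \<and>
     (\<forall>y\<in>carrier (grp2 H). \<phi>1 (bd H y) = bd G (\<phi>2 y)) \<and>
     (\<forall>h\<in>carrier (grp1 H). \<forall>y\<in>carrier (grp2 H). \<phi>2 (act H h y) = act G (\<phi>1 h) (\<phi>2 y)) \<and>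
     (\<forall>h\<in>carrier (grp1 H). grading G (\<phi>1 h) = grading H h)"


section \<open>2-groups and their equivalences\<close>

text \<open>
  A 2-group is a strict 2-category with one object whose 1- and 2-morphisms are all invertible.
  Compositions are written in the order of functions: \<open>vcomp b a\<close> is \<open>b\<close> after \<open>a\<close>, and
  \<open>hcomp a' a\<close> goes from \<open>comp1 (src a') (src a)\<close> to \<open>comp1 (tgt a') (tgt a)\<close>.
\<close>

record ('o, 't) two_group =
  mor1 :: "'o set"
  comp1 :: "'o \<Rightarrow> 'o \<Rightarrow> 'o"
  unit1 :: 'o
  mor2 :: "'t set"
  src :: "'t \<Rightarrow> 'o"
  tgt :: "'t \<Rightarrow> 'o"
  id2 :: "'o \<Rightarrow> 't"
  vcomp :: "'t \<Rightarrow> 't \<Rightarrow> 't"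
  hcomp :: "'t \<Rightarrow> 't \<Rightarrow> 't"

text \<open>The pair \<open>(x, g)\<close> is the 2-morphism \<open>x : g \<Rightarrow> \<partial>(x)g\<close>.\<close>

definition two_group_of :: "('g, 'x) crossed_module \<Rightarrow> ('g, 'x \<times> 'g) two_group" where
  "two_group_of G =
    \<lparr>mor1 = carrier (grp1 G),
     comp1 = (\<lambda>g' g. g' \<otimes>\<^bsub>grp1 G\<^esub> g),
     unit1 = \<one>\<^bsub>grp1 G\<^esub>,
     mor2 = carrier (grp2 G) \<times> carrier (grp1 G),
     src = snd,
     tgt = (\<lambda>(x, g). bd G x \<otimes>\<^bsub>grp1 G\<^esub> g),
     id2 = (\<lambda>g. (\<one>\<^bsub>grp2 G\<^esub>, g)),
     vcomp = (\<lambda>(x2, g2) (x1, g1). (x2 \<otimes>\<^bsub>grp2 G\<^esub> x1, g1)),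
     hcomp = (\<lambda>(x, g) (x', g'). (x \<otimes>\<^bsub>grp2 G\<^esub> act G g x', g \<otimes>\<^bsub>grp1 G\<^esub> g'))\<rparr>"

definition cell2 :: "('o, 't) two_group \<Rightarrow> 't \<Rightarrow> 'o \<Rightarrow> 'o \<Rightarrow> bool" where
  "cell2 C a f g \<longleftrightarrow> a \<in> mor2 C \<and> src C a = f \<and> tgt C a = g"

text \<open>
  Homomorphisms of 2-groups are pseudofunctors, with structure 2-morphisms
  \<open>hom_comp g' g : F g' F g \<Rightarrow> F (g' g)\<close> and \<open>hom_unit : 1 \<Rightarrow> F 1\<close>. Invertibility of these need
  not be required, as every 2-morphism of a 2-group is invertible.
\<close>

record ('o, 't, 'p, 'u) two_group_hom =
  map1 :: "'o \<Rightarrow> 'p"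
  map2 :: "'t \<Rightarrow> 'u"
  hom_comp :: "'o \<Rightarrow> 'o \<Rightarrow> 'u"
  hom_unit :: 'u

definition is_two_group_hom ::
  "('o, 't) two_group \<Rightarrow> ('p, 'u) two_group \<Rightarrow> ('o, 't, 'p, 'u) two_group_hom \<Rightarrow> bool"
where
  "is_two_group_hom C D F \<longleftrightarrow>
    (\<forall>g\<in>mor1 C. map1 F g \<in> mor1 D) \<and>
    (\<forall>a\<in>mor2 C. cell2 D (map2 F a) (map1 F (src C a)) (map1 F (tgt C a))) \<and>
    (\<forall>g\<in>mor1 C. map2 F (id2 C g) = id2 D (map1 F g)) \<and>
    (\<forall>b\<in>mor2 C. \<forall>a\<in>mor2 C. src C b = tgt C a \<longrightarrow>
       map2 F (vcomp C b a) = vcomp D (map2 F b) (map2 F a)) \<and>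
    (\<forall>g'\<in>mor1 C. \<forall>g\<in>mor1 C.
       cell2 D (hom_comp F g' g) (comp1 D (map1 F g') (map1 F g)) (map1 F (comp1 C g' g))) \<and>
    cell2 D (hom_unit F) (unit1 D) (map1 F (unit1 C)) \<and>
    (\<forall>a'\<in>mor2 C. \<forall>a\<in>mor2 C.
       vcomp D (hom_comp F (tgt C a') (tgt C a)) (hcomp D (map2 F a') (map2 F a)) =
       vcomp D (map2 F (hcomp C a' a)) (hom_comp F (src C a') (src C a))) \<and>
    (\<forall>g3\<in>mor1 C. \<forall>g2\<in>mor1 C. \<forall>g1\<in>mor1 C.
       vcomp D (hom_comp F (comp1 C g3 g2) g1)
               (hcomp D (hom_comp F g3 g2) (id2 D (map1 F g1))) =
       vcomp D (hom_comp F g3 (comp1 C g2 g1))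
               (hcomp D (id2 D (map1 F g3)) (hom_comp F g2 g1))) \<and>
    (\<forall>g\<in>mor1 C.
       vcomp D (hom_comp F (unit1 C) g) (hcomp D (hom_unit F) (id2 D (map1 F g))) =
         id2 D (map1 F g) \<and>
       vcomp D (hom_comp F g (unit1 C)) (hcomp D (id2 D (map1 F g)) (hom_unit F)) =
         id2 D (map1 F g))"

definition id_two_group_hom :: "('o, 't) two_group \<Rightarrow> ('o, 't, 'o, 't) two_group_hom" where
  "id_two_group_hom C =
    \<lparr>map1 = (\<lambda>g. g), map2 = (\<lambda>a. a),
     hom_comp = (\<lambda>g' g. id2 C (comp1 C g' g)), hom_unit = id2 C (unit1 C)\<rparr>"

definition comp_two_group_hom ::
  "('q, 'v) two_group \<Rightarrow> ('p, 'u, 'q, 'v) two_group_hom \<Rightarrow> ('o, 't, 'p, 'u) two_group_hom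
     \<Rightarrow> ('o, 't, 'q, 'v) two_group_hom"
where
  "comp_two_group_hom Z F E =
    \<lparr>map1 = map1 F \<circ> map1 E, map2 = map2 F \<circ> map2 E,
     hom_comp = (\<lambda>g' g. vcomp Z (map2 F (hom_comp E g' g)) (hom_comp F (map1 E g') (map1 E g))),
     hom_unit = vcomp Z (map2 F (hom_unit E)) (hom_unit F)\<rparr>"

text \<open>
  A pseudonatural transformation \<open>F \<Rightarrow> F'\<close> between homomorphisms \<open>C \<rightarrow> D\<close>: a 1-morphism \<open>t\<close> of \<open>D\<close>
  and 2-morphisms \<open>s g : F' g t \<Rightarrow> t F g\<close>. Since \<open>t\<close> and all 2-morphisms are invertible, every
  pseudonatural transformation is an equivalence.
\<close>

definition pseudonat ::
  "('o, 't) two_group \<Rightarrow> ('p, 'u) two_group \<Rightarrow> ('o, 't, 'p, 'u) two_group_hom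
     \<Rightarrow> ('o, 't, 'p, 'u) two_group_hom \<Rightarrow> 'p \<Rightarrow> ('o \<Rightarrow> 'u) \<Rightarrow> bool"
where
  "pseudonat C D F F' t s \<longleftrightarrow>
    t \<in> mor1 D \<and>
    (\<forall>g\<in>mor1 C. cell2 D (s g) (comp1 D (map1 F' g) t) (comp1 D t (map1 F g))) \<and>
    (\<forall>a\<in>mor2 C.
       vcomp D (s (tgt C a)) (hcomp D (map2 F' a) (id2 D t)) =
       vcomp D (hcomp D (id2 D t) (map2 F a)) (s (src C a))) \<and>
    (\<forall>g'\<in>mor1 C. \<forall>g\<in>mor1 C.
       vcomp D (s (comp1 C g' g)) (hcomp D (hom_comp F' g' g) (id2 D t)) =
       vcomp D (hcomp D (id2 D t) (hom_comp F g' g))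
         (vcomp D (hcomp D (s g') (id2 D (map1 F g))) (hcomp D (id2 D (map1 F' g')) (s g)))) \<and>
    vcomp D (s (unit1 C)) (hcomp D (hom_unit F') (id2 D t)) = hcomp D (id2 D t) (hom_unit F)"

definition two_group_equivalence ::
  "('o, 't) two_group \<Rightarrow> ('p, 'u) two_group \<Rightarrow> ('o, 't, 'p, 'u) two_group_hom \<Rightarrow> bool"
where
  "two_group_equivalence C D F \<longleftrightarrow>
    is_two_group_hom C D F \<and>
    (\<exists>E. is_two_group_hom D C E \<and>
      (\<exists>t s. pseudonat C C (comp_two_group_hom C E F) (id_two_group_hom C) t s) \<and>
      (\<exists>t s. pseudonat D D (comp_two_group_hom D F E) (id_two_group_hom D) t s))"

definition induced_hom ::
  "('g, 'x) crossed_module \<Rightarrow> ('h \<Rightarrow> 'g) \<Rightarrow> ('y \<Rightarrow> 'x)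
     \<Rightarrow> ('h, 'y \<times> 'h, 'g, 'x \<times> 'g) two_group_hom"
where
  "induced_hom G \<phi>1 \<phi>2 =
    \<lparr>map1 = \<phi>1, map2 = (\<lambda>(y, h). (\<phi>2 y, \<phi>1 h)),
     hom_comp = (\<lambda>h' h. id2 (two_group_of G) (\<phi>1 h' \<otimes>\<^bsub>grp1 G\<^esub> \<phi>1 h)),
     hom_unit = id2 (two_group_of G) \<one>\<^bsub>grp1 G\<^esub>\<rparr>"


section \<open>Algebras and generalized automorphisms\<close>

text \<open>The library locale \<^locale>\<open>algebra\<close> is about commutative algebras only.\<close>

locale assoc_algebra =
  fixes K :: "'k ring" and A :: "('k, 'a) module"
  assumes field: "field K"
    and ring: "ring A"
    and module: "module K A"
    and smult_mult_left: "\<lbrakk>k \<in> carrier K; x \<in> carrier A; y \<in> carrier A\<rbrakk> \<Longrightarrow>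
      (k \<odot>\<^bsub>A\<^esub> x) \<otimes>\<^bsub>A\<^esub> y = k \<odot>\<^bsub>A\<^esub> (x \<otimes>\<^bsub>A\<^esub> y)"
    and smult_mult_right: "\<lbrakk>k \<in> carrier K; x \<in> carrier A; y \<in> carrier A\<rbrakk> \<Longrightarrow>
      x \<otimes>\<^bsub>A\<^esub> (k \<odot>\<^bsub>A\<^esub> y) = k \<odot>\<^bsub>A\<^esub> (x \<otimes>\<^bsub>A\<^esub> y)"

definition opp :: "('k, 'a) module \<Rightarrow> ('k, 'a) module" where
  "opp A = A\<lparr>monoid.mult := (\<lambda>x y. y \<otimes>\<^bsub>A\<^esub> x)\<rparr>"

definition signed_alg :: "int \<Rightarrow> ('k, 'a) module \<Rightarrow> ('k, 'a) module" where
  "signed_alg s A = (if s = 1 then A else opp A)"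

definition alg_iso :: "'k ring \<Rightarrow> ('k, 'a) module \<Rightarrow> ('k, 'b) module \<Rightarrow> ('a \<Rightarrow> 'b) set" where
  "alg_iso K A B = {f \<in> ring_iso A B.
     \<forall>k\<in>carrier K. \<forall>a\<in>carrier A. f (k \<odot>\<^bsub>A\<^esub> a) = k \<odot>\<^bsub>B\<^esub> f a}"

text \<open>
  Elements are pairs of a degree and a map: for commutative algebras the same map occurs in both
  degrees. As in \<^const>\<open>BijGroup\<close>, maps are extensional so that they are determined by their
  values on the carrier.
\<close>

definition Aut_gen :: "'k ring \<Rightarrow> ('k, 'a) module \<Rightarrow> (int \<times> ('a \<Rightarrow> 'a)) monoid" where
  "Aut_gen K A =
    \<lparr>carrier = {(s, f). s \<in> {1, -1} \<and> f \<in> alg_iso K (signed_alg s A) A \<inter> extensional (carrier A)},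
     monoid.mult = (\<lambda>(s, f) (t, g). (s * t, compose (carrier A) f g)),
     one = (1, \<lambda>a\<in>carrier A. a)\<rparr>"

definition AUT_gen ::
  "'k ring \<Rightarrow> ('k, 'a) module \<Rightarrow> (int \<times> ('a \<Rightarrow> 'a), 'a) crossed_module"
where
  "AUT_gen K A =
    \<lparr>grp1 = Aut_gen K A,
     grp2 = units_of A,
     bd = (\<lambda>y. (1, \<lambda>a\<in>carrier A. y \<otimes>\<^bsub>A\<^esub> a \<otimes>\<^bsub>A\<^esub> inv\<^bsub>A\<^esub> y)),
     act = (\<lambda>(s, f) y. f (if s = 1 then y else inv\<^bsub>A\<^esub> y)),
     grading = fst\<rparr>"


section \<open>N-weak algebras\<close>

record ('g, 'x, 'a) weak_action =
  om1 :: "'g \<Rightarrow> int \<times> ('a \<Rightarrow> 'a)"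
  om2 :: "'x \<Rightarrow> 'a"
  om3 :: "'g \<Rightarrow> 'g \<Rightarrow> 'a"

locale N_weak_algebra = graded_crossed_module G + assoc_algebra K A
  for K :: "'k ring" and G :: "('g, 'x) crossed_module" and A :: "('k, 'a) module"
    and w :: "('g, 'x, 'a) weak_action" +
  assumes om1_closed: "g \<in> carrier (grp1 G) \<Longrightarrow> om1 w g \<in> carrier (Aut_gen K A)"
    and om1_degree: "g \<in> carrier (grp1 G) \<Longrightarrow> grading (AUT_gen K A) (om1 w g) = grading G g"
    and om1_one: "om1 w \<one>\<^bsub>grp1 G\<^esub> = \<one>\<^bsub>Aut_gen K A\<^esub>"
    and om2_closed: "x \<in> carrier (grp2 G) \<Longrightarrow> om2 w x \<in> Units A"
    and om2_one: "om2 w \<one>\<^bsub>grp2 G\<^esub> = \<one>\<^bsub>A\<^esub>"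
    and om3_closed: "\<lbrakk>g \<in> carrier (grp1 G); h \<in> carrier (grp1 G)\<rbrakk> \<Longrightarrow> om3 w g h \<in> Units A"
    and om3_one_left: "g \<in> carrier (grp1 G) \<Longrightarrow> om3 w \<one>\<^bsub>grp1 G\<^esub> g = \<one>\<^bsub>A\<^esub>"
    and om3_one_right: "g \<in> carrier (grp1 G) \<Longrightarrow> om3 w g \<one>\<^bsub>grp1 G\<^esub> = \<one>\<^bsub>A\<^esub>"
    and om1_mult: "\<lbrakk>g2 \<in> carrier (grp1 G); g1 \<in> carrier (grp1 G)\<rbrakk> \<Longrightarrow>
      om1 w (g2 \<otimes>\<^bsub>grp1 G\<^esub> g1) =
        bd (AUT_gen K A) (om3 w g2 g1) \<otimes>\<^bsub>Aut_gen K A\<^esub> om1 w g2 \<otimes>\<^bsub>Aut_gen K A\<^esub> om1 w g1"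
    and om2_mult: "\<lbrakk>x2 \<in> carrier (grp2 G); x1 \<in> carrier (grp2 G)\<rbrakk> \<Longrightarrow>
      om2 w (x2 \<otimes>\<^bsub>grp2 G\<^esub> x1) = om3 w (bd G x2) (bd G x1) \<otimes>\<^bsub>A\<^esub> om2 w x2 \<otimes>\<^bsub>A\<^esub> om2 w x1"
    and om1_bd: "x \<in> carrier (grp2 G) \<Longrightarrow> om1 w (bd G x) = bd (AUT_gen K A) (om2 w x)"
    and om3_cocycle:
      "\<lbrakk>g3 \<in> carrier (grp1 G); g2 \<in> carrier (grp1 G); g1 \<in> carrier (grp1 G)\<rbrakk> \<Longrightarrow>
      om3 w (g3 \<otimes>\<^bsub>grp1 G\<^esub> g2) g1 \<otimes>\<^bsub>A\<^esub> om3 w g3 g2 =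
        om3 w g3 (g2 \<otimes>\<^bsub>grp1 G\<^esub> g1) \<otimes>\<^bsub>A\<^esub> act (AUT_gen K A) (om1 w g3) (om3 w g2 g1)"
    and om2_act: "\<lbrakk>g \<in> carrier (grp1 G); x \<in> carrier (grp2 G)\<rbrakk> \<Longrightarrow>
      om2 w (act G g x) =
        om3 w (g \<otimes>\<^bsub>grp1 G\<^esub> bd G x) (inv\<^bsub>grp1 G\<^esub> g) \<otimes>\<^bsub>A\<^esub> om3 w g (bd G x)
          \<otimes>\<^bsub>A\<^esub> act (AUT_gen K A) (om1 w g) (om2 w x)
          \<otimes>\<^bsub>A\<^esub> inv\<^bsub>A\<^esub> (om3 w g (inv\<^bsub>grp1 G\<^esub> g))"

definition pullback_action ::
  "('g, 'x, 'a) weak_action \<Rightarrow> ('h \<Rightarrow> 'g) \<Rightarrow> ('y \<Rightarrow> 'x) \<Rightarrow> ('h, 'y, 'a) weak_action"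
where
  "pullback_action w \<phi>1 \<phi>2 =
    \<lparr>om1 = om1 w \<circ> \<phi>1, om2 = om2 w \<circ> \<phi>2, om3 = (\<lambda>h' h. om3 w (\<phi>1 h') (\<phi>1 h))\<rparr>"

definition strict_action ::
  "('k, 'a) module \<Rightarrow> ('h \<Rightarrow> int \<times> ('a \<Rightarrow> 'a)) \<Rightarrow> ('y \<Rightarrow> 'a) \<Rightarrow> ('h, 'y, 'a) weak_action"
where
  "strict_action A \<psi>1 \<psi>2 = \<lparr>om1 = \<psi>1, om2 = \<psi>2, om3 = (\<lambda>_ _. \<one>\<^bsub>A\<^esub>)\<rparr>"


section \<open>Bimodules\<close>

text \<open>
  As with the library's \<^locale>\<open>module\<close>, the fields \<open>mult\<close> and \<open>one\<close> inherited from the record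
  \<open>ring\<close> carry no meaning.
\<close>

record ('k, 'b, 'a, 'm) bimodule = "('k, 'm) module" +
  lact :: "'b \<Rightarrow> 'm \<Rightarrow> 'm"
  ract :: "'m \<Rightarrow> 'a \<Rightarrow> 'm"

text \<open>\<open>bimodule K B A M\<close>: \<open>M\<close> is a \<open>B\<close>-\<open>A\<close>-bimodule on which \<open>K\<close> acts centrally.\<close>

locale bimodule = B: assoc_algebra K B + A: assoc_algebra K A
  for K :: "'k ring" and B :: "('k, 'b) module" and A :: "('k, 'a) module" +
  fixes M :: "('k, 'b, 'a, 'm) bimodule"
  assumes M_module: "module K M"
    and lact_closed: "\<lbrakk>b \<in> carrier B; m \<in> carrier M\<rbrakk> \<Longrightarrow> lact M b m \<in> carrier M"
    and lact_add_left: "\<lbrakk>b \<in> carrier B; b' \<in> carrier B; m \<in> carrier M\<rbrakk> \<Longrightarrow>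
      lact M (b \<oplus>\<^bsub>B\<^esub> b') m = lact M b m \<oplus>\<^bsub>M\<^esub> lact M b' m"
    and lact_add_right: "\<lbrakk>b \<in> carrier B; m \<in> carrier M; m' \<in> carrier M\<rbrakk> \<Longrightarrow>
      lact M b (m \<oplus>\<^bsub>M\<^esub> m') = lact M b m \<oplus>\<^bsub>M\<^esub> lact M b m'"
    and lact_mult: "\<lbrakk>b \<in> carrier B; b' \<in> carrier B; m \<in> carrier M\<rbrakk> \<Longrightarrow>
      lact M (b \<otimes>\<^bsub>B\<^esub> b') m = lact M b (lact M b' m)"
    and lact_one: "m \<in> carrier M \<Longrightarrow> lact M \<one>\<^bsub>B\<^esub> m = m"
    and ract_closed: "\<lbrakk>m \<in> carrier M; a \<in> carrier A\<rbrakk> \<Longrightarrow> ract M m a \<in> carrier M"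
    and ract_add_left: "\<lbrakk>m \<in> carrier M; m' \<in> carrier M; a \<in> carrier A\<rbrakk> \<Longrightarrow>
      ract M (m \<oplus>\<^bsub>M\<^esub> m') a = ract M m a \<oplus>\<^bsub>M\<^esub> ract M m' a"
    and ract_add_right: "\<lbrakk>m \<in> carrier M; a \<in> carrier A; a' \<in> carrier A\<rbrakk> \<Longrightarrow>
      ract M m (a \<oplus>\<^bsub>A\<^esub> a') = ract M m a \<oplus>\<^bsub>M\<^esub> ract M m a'"
    and ract_mult: "\<lbrakk>m \<in> carrier M; a \<in> carrier A; a' \<in> carrier A\<rbrakk> \<Longrightarrow>
      ract M m (a \<otimes>\<^bsub>A\<^esub> a') = ract M (ract M m a) a'"
    and ract_one: "m \<in> carrier M \<Longrightarrow> ract M m \<one>\<^bsub>A\<^esub> = m"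
    and lact_ract: "\<lbrakk>b \<in> carrier B; m \<in> carrier M; a \<in> carrier A\<rbrakk> \<Longrightarrow>
      ract M (lact M b m) a = lact M b (ract M m a)"
    and scalar_left: "\<lbrakk>k \<in> carrier K; m \<in> carrier M\<rbrakk> \<Longrightarrow>
      lact M (k \<odot>\<^bsub>B\<^esub> \<one>\<^bsub>B\<^esub>) m = k \<odot>\<^bsub>M\<^esub> m"
    and scalar_right: "\<lbrakk>k \<in> carrier K; m \<in> carrier M\<rbrakk> \<Longrightarrow>
      ract M m (k \<odot>\<^bsub>A\<^esub> \<one>\<^bsub>A\<^esub>) = k \<odot>\<^bsub>M\<^esub> m"

definition linear_iso ::
  "'k ring \<Rightarrow> ('k, 'm, 'r) module_scheme \<Rightarrow> ('k, 'n, 's) module_scheme \<Rightarrow> ('m \<Rightarrow> 'n) set"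
where
  "linear_iso K M N = {f. bij_betw f (carrier M) (carrier N) \<and>
     (\<forall>x\<in>carrier M. \<forall>y\<in>carrier M. f (x \<oplus>\<^bsub>M\<^esub> y) = f x \<oplus>\<^bsub>N\<^esub> f y) \<and>
     (\<forall>k\<in>carrier K. \<forall>x\<in>carrier M. f (k \<odot>\<^bsub>M\<^esub> x) = k \<odot>\<^bsub>N\<^esub> f x)}"

definition bimodule_iso ::
  "'k ring \<Rightarrow> ('k, 'b) module \<Rightarrow> ('k, 'a) module \<Rightarrow> ('k, 'b, 'a, 'm) bimodule
     \<Rightarrow> ('k, 'b, 'a, 'n) bimodule \<Rightarrow> ('m \<Rightarrow> 'n) set"
where
  "bimodule_iso K B A M N = {f \<in> linear_iso K M N.
     \<forall>b\<in>carrier B. \<forall>m\<in>carrier M. \<forall>a\<in>carrier A.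
       f (lact M b (ract M m a)) = lact N b (ract N (f m) a)}"

definition regular_bimodule :: "('k, 'a) module \<Rightarrow> ('k, 'a, 'a, 'a) bimodule" where
  "regular_bimodule A =
    \<lparr>carrier = carrier A, monoid.mult = monoid.mult A, one = \<one>\<^bsub>A\<^esub>, ring.zero = \<zero>\<^bsub>A\<^esub>, add = add A,
     smult = smult A, lact = monoid.mult A, ract = monoid.mult A\<rparr>"

text \<open>
  \<open>tensor_bimodule A M N\<close> is \<open>M \<otimes>\<^sub>A N\<close>, the quotient of the free abelian group on the set
  \<open>M \<times> N\<close> by the subgroup generated by the usual relations. \<open>tensor_map A M N f\<close> is the
  endomorphism of the quotient induced by a map \<open>f\<close> of \<open>M \<times> N\<close> into itself.
\<close>

definition tensor_relations ::
  "('k, 'a) module \<Rightarrow> ('k, 'c, 'a, 'm) bimodule \<Rightarrow> ('k, 'a, 'b, 'n) bimodule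
     \<Rightarrow> ('m \<times> 'n \<Rightarrow>\<^sub>0 int) set"
where
  "tensor_relations A M N =
     {frag_of (m \<oplus>\<^bsub>M\<^esub> m', n) - frag_of (m, n) - frag_of (m', n) | m m' n.
        m \<in> carrier M \<and> m' \<in> carrier M \<and> n \<in> carrier N} \<union>
     {frag_of (m, n \<oplus>\<^bsub>N\<^esub> n') - frag_of (m, n) - frag_of (m, n') | m n n'.
        m \<in> carrier M \<and> n \<in> carrier N \<and> n' \<in> carrier N} \<union>
     {frag_of (ract M m a, n) - frag_of (m, lact N a n) | m a n.
        m \<in> carrier M \<and> a \<in> carrier A \<and> n \<in> carrier N}"

definition tensor_subgroup ::
  "('k, 'a) module \<Rightarrow> ('k, 'c, 'a, 'm) bimodule \<Rightarrow> ('k, 'a, 'b, 'n) bimodule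
     \<Rightarrow> ('m \<times> 'n \<Rightarrow>\<^sub>0 int) set"
where
  "tensor_subgroup A M N =
     generate (free_Abelian_group (carrier M \<times> carrier N)) (tensor_relations A M N)"

definition tensor_group ::
  "('k, 'a) module \<Rightarrow> ('k, 'c, 'a, 'm) bimodule \<Rightarrow> ('k, 'a, 'b, 'n) bimodule
     \<Rightarrow> ('m \<times> 'n \<Rightarrow>\<^sub>0 int) set monoid"
where
  "tensor_group A M N =
     free_Abelian_group (carrier M \<times> carrier N) Mod tensor_subgroup A M N"

definition tensor_map ::
  "('k, 'a) module \<Rightarrow> ('k, 'c, 'a, 'm) bimodule \<Rightarrow> ('k, 'a, 'b, 'n) bimodule
     \<Rightarrow> ('m \<times> 'n \<Rightarrow> 'm \<times> 'n) \<Rightarrow> ('m \<times> 'n \<Rightarrow>\<^sub>0 int) set \<Rightarrow> ('m \<times> 'n \<Rightarrow>\<^sub>0 int) set"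
where
  "tensor_map A M N f T =
     (\<Union>z\<in>T. tensor_subgroup A M N
        #>\<^bsub>free_Abelian_group (carrier M \<times> carrier N)\<^esub> frag_extend (\<lambda>p. frag_of (f p)) z)"

definition tensor_bimodule ::
  "('k, 'a) module \<Rightarrow> ('k, 'c, 'a, 'm) bimodule \<Rightarrow> ('k, 'a, 'b, 'n) bimodule
     \<Rightarrow> ('k, 'c, 'b, ('m \<times> 'n \<Rightarrow>\<^sub>0 int) set) bimodule"
where
  "tensor_bimodule A M N =
    \<lparr>carrier = carrier (tensor_group A M N), monoid.mult = undefined, one = undefined,
     ring.zero = \<one>\<^bsub>tensor_group A M N\<^esub>, add = monoid.mult (tensor_group A M N),
     smult = (\<lambda>k. tensor_map A M N (\<lambda>(m, n). (k \<odot>\<^bsub>M\<^esub> m, n))),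
     lact = (\<lambda>c. tensor_map A M N (\<lambda>(m, n). (lact M c m, n))),
     ract = (\<lambda>T b. tensor_map A M N (\<lambda>(m, n). (m, ract N n b)) T)\<rparr>"

text \<open>
  Fixing the element type of the inverse bimodule is no restriction: an inverse of \<open>M\<close> is
  isomorphic to the module of right \<open>A\<close>-linear maps \<open>M \<rightarrow> A\<close>.
\<close>

definition invertible_bimodule ::
  "'k ring \<Rightarrow> ('k, 'b) module \<Rightarrow> ('k, 'a) module \<Rightarrow> ('k, 'b, 'a, 'm) bimodule \<Rightarrow> bool"
where
  "invertible_bimodule K B A M \<longleftrightarrow>
    bimodule K B A M \<and>
    (\<exists>N :: ('k, 'a, 'b, 'm \<Rightarrow> 'a) bimodule.
      bimodule K A B N \<and>
      bimodule_iso K B B (tensor_bimodule A M N) (regular_bimodule B) \<noteq> {} \<and>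
      bimodule_iso K A A (tensor_bimodule B N M) (regular_bimodule A) \<noteq> {})"

text \<open>
  \<open>dual_bimodule B A M\<close> is \<open>M\<degree>\<close> as a bimodule over the opposite algebras of \<open>B\<close> and \<open>A\<close>;
  \<open>K\<close>-linearity of its elements follows from right \<open>A\<close>-linearity.
\<close>

definition dual_bimodule ::
  "('k, 'b) module \<Rightarrow> ('k, 'a) module \<Rightarrow> ('k, 'b, 'a, 'm) bimodule
     \<Rightarrow> ('k, 'b, 'a, 'm \<Rightarrow> 'a) bimodule"
where
  "dual_bimodule B A M =
    \<lparr>carrier = {f \<in> carrier M \<rightarrow>\<^sub>E carrier A.
       (\<forall>m\<in>carrier M. \<forall>m'\<in>carrier M. f (m \<oplus>\<^bsub>M\<^esub> m') = f m \<oplus>\<^bsub>A\<^esub> f m') \<and>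
       (\<forall>m\<in>carrier M. \<forall>a\<in>carrier A. f (ract M m a) = f m \<otimes>\<^bsub>A\<^esub> a)},
     monoid.mult = undefined, one = undefined,
     ring.zero = (\<lambda>m\<in>carrier M. \<zero>\<^bsub>A\<^esub>),
     add = (\<lambda>f f'. \<lambda>m\<in>carrier M. f m \<oplus>\<^bsub>A\<^esub> f' m),
     smult = (\<lambda>k f. \<lambda>m\<in>carrier M. k \<odot>\<^bsub>A\<^esub> f m),
     lact = (\<lambda>b f. \<lambda>m\<in>carrier M. f (lact M b m)),
     ract = (\<lambda>f a. \<lambda>m\<in>carrier M. a \<otimes>\<^bsub>A\<^esub> f m)\<rparr>"

definition ev ::
  "('k, 'b) module \<Rightarrow> ('k, 'a) module \<Rightarrow> ('k, 'b, 'a, 'm) bimodule \<Rightarrow> 'm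
     \<Rightarrow> ('m \<Rightarrow> 'a) \<Rightarrow> 'a"
where
  "ev B A M m = (\<lambda>f\<in>carrier (dual_bimodule B A M). f m)"

text \<open>
  For \<open>f : N \<rightarrow> M\<close> bijective and \<open>\<alpha>\<close> a map on coefficients, \<open>dual_transport \<alpha> N M f\<close> is the map
  \<open>u \<mapsto> \<alpha> \<circ> u \<circ> f\<^sup>-\<^sup>1\<close> from \<open>N\<degree>\<close> to \<open>M\<degree>\<close>.
\<close>

definition dual_transport ::
  "('a \<Rightarrow> 'a) \<Rightarrow> ('k, 'b, 'a, 'n) bimodule \<Rightarrow> ('k, 'b, 'a, 'm) bimodule
     \<Rightarrow> ('n \<Rightarrow> 'm) \<Rightarrow> ('n \<Rightarrow> 'a) \<Rightarrow> 'm \<Rightarrow> 'a"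
where
  "dual_transport \<alpha> N M f u = (\<lambda>m\<in>carrier M. \<alpha> (u (inv_into (carrier N) f m)))"


section \<open>Morita equivalence of N-weak algebras\<close>

text \<open>
  The domain of \<open>\<omega>\<^sub>M(g)\<close> is \<open>M\<close> or \<open>M\<degree>\<close> according to the degree of \<open>g\<close>, and these have different
  types. Hence \<open>\<omega>\<^sub>M\<close> consists of two functions, \<open>p\<close> for degree \<open>1\<close> and \<open>q\<close> for degree \<open>-1\<close>; their
  values in the respective other degree are irrelevant.
  Accordingly the formula for \<open>\<omega>\<^sub>M(h2 h1)\<close> is split by the degrees of \<open>h2\<close> and \<open>h1\<close>, in this order.
\<close>

locale N_weak_morphism =
  A: N_weak_algebra K H A wA + B: N_weak_algebra K H B wB + M: bimodule K B A M
  for K :: "'k ring" and H :: "('h, 'y) crossed_module"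
    and A :: "('k, 'a) module" and wA :: "('h, 'y, 'a) weak_action"
    and B :: "('k, 'b) module" and wB :: "('h, 'y, 'b) weak_action"
    and M :: "('k, 'b, 'a, 'm) bimodule" +
  fixes p :: "'h \<Rightarrow> 'm \<Rightarrow> 'm" and q :: "'h \<Rightarrow> ('m \<Rightarrow> 'a) \<Rightarrow> 'm"
  assumes iso_pos: "\<lbrakk>h \<in> carrier (grp1 H); grading H h = 1\<rbrakk> \<Longrightarrow> p h \<in> linear_iso K M M"
    and iso_neg: "\<lbrakk>h \<in> carrier (grp1 H); grading H h = -1\<rbrakk> \<Longrightarrow>
      q h \<in> linear_iso K (dual_bimodule B A M) M"
    and unit: "m \<in> carrier M \<Longrightarrow> p \<one>\<^bsub>grp1 H\<^esub> m = m"
    and bilinear_pos: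
      "\<lbrakk>h \<in> carrier (grp1 H); grading H h = 1; b \<in> carrier B; m \<in> carrier M; a \<in> carrier A\<rbrakk> \<Longrightarrow>
      p h (lact M b (ract M m a)) =
        lact M (snd (om1 wB h) b) (ract M (p h m) (snd (om1 wA h) a))"
    and bilinear_neg:
      "\<lbrakk>h \<in> carrier (grp1 H); grading H h = -1; b \<in> carrier B;
        f \<in> carrier (dual_bimodule B A M); a \<in> carrier A\<rbrakk> \<Longrightarrow>
      q h (lact (dual_bimodule B A M) b (ract (dual_bimodule B A M) f a)) =
        lact M (snd (om1 wB h) b) (ract M (q h f) (snd (om1 wA h) a))"
    and comp_pos_pos:
      "\<lbrakk>h2 \<in> carrier (grp1 H); h1 \<in> carrier (grp1 H); grading H h2 = 1; grading H h1 = 1;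
        m \<in> carrier M\<rbrakk> \<Longrightarrow>
      p (h2 \<otimes>\<^bsub>grp1 H\<^esub> h1) m =
        lact M (om3 wB h2 h1) (ract M (p h2 (p h1 m)) (inv\<^bsub>A\<^esub> (om3 wA h2 h1)))"
    and comp_pos_neg:
      "\<lbrakk>h2 \<in> carrier (grp1 H); h1 \<in> carrier (grp1 H); grading H h2 = 1; grading H h1 = -1;
        f \<in> carrier (dual_bimodule B A M)\<rbrakk> \<Longrightarrow>
      q (h2 \<otimes>\<^bsub>grp1 H\<^esub> h1) f =
        lact M (om3 wB h2 h1) (ract M (p h2 (q h1 f)) (inv\<^bsub>A\<^esub> (om3 wA h2 h1)))"
    and comp_neg_pos:
      "\<lbrakk>h2 \<in> carrier (grp1 H); h1 \<in> carrier (grp1 H); grading H h2 = -1; grading H h1 = 1;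
        f \<in> carrier (dual_bimodule B A M)\<rbrakk> \<Longrightarrow>
      q (h2 \<otimes>\<^bsub>grp1 H\<^esub> h1) f =
        lact M (om3 wB h2 h1)
          (ract M (q h2 (dual_transport (snd (om1 wA h1)) M M (p h1) f))
            (inv\<^bsub>A\<^esub> (om3 wA h2 h1)))"
    and comp_neg_neg:
      "\<lbrakk>h2 \<in> carrier (grp1 H); h1 \<in> carrier (grp1 H); grading H h2 = -1; grading H h1 = -1;
        m \<in> carrier M\<rbrakk> \<Longrightarrow>
      p (h2 \<otimes>\<^bsub>grp1 H\<^esub> h1) m =
        lact M (om3 wB h2 h1)
          (ract M (q h2 (dual_transport (snd (om1 wA h1)) (dual_bimodule B A M) M (q h1)
                     (ev B A M m)))
            (inv\<^bsub>A\<^esub> (om3 wA h2 h1)))"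
    and bd_action: "\<lbrakk>y \<in> carrier (grp2 H); m \<in> carrier M\<rbrakk> \<Longrightarrow>
      p (bd H y) m = lact M (om2 wB y) (ract M m (inv\<^bsub>A\<^esub> (om2 wA y)))"

text \<open>The first argument determines the type of the elements of the bimodule.\<close>

definition Morita_equivalent ::
  "'m itself \<Rightarrow> 'k ring \<Rightarrow> ('h, 'y) crossed_module \<Rightarrow> ('k, 'a) module
     \<Rightarrow> ('h, 'y, 'a) weak_action \<Rightarrow> ('k, 'b) module \<Rightarrow> ('h, 'y, 'b) weak_action \<Rightarrow> bool"
where
  "Morita_equivalent (_ :: 'm itself) K H A wA B wB \<longleftrightarrow>
    (\<exists>(M :: ('k, 'b, 'a, 'm) bimodule) p q.
      N_weak_morphism K H A wA B wB M p q \<and> invertible_bimodule K B A M)"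

end

theory Submission
  imports Defs
begin

text \<open>
  Replace \<open>G\<^sub>1\<close> by the set \<open>A\<^sup>\<times> \<times> G\<^sub>1\<close>, thought of as elements \<open>g\<close> together with a correction \<open>a\<close> of
  \<open>\<omega>\<^sub>1(g)\<close> to \<open>\<partial>(a) \<omega>\<^sub>1(g)\<close>. The cocycle \<open>\<omega>\<^sub>3\<close> twists its product so that
  \<open>(a, g) \<mapsto> \<partial>(a) \<omega>\<^sub>1(g)\<close> becomes a homomorphism; associativity is the cocycle identity. Pulling back
  \<open>\<partial> : G\<^sub>2 \<rightarrow> G\<^sub>1\<close> along the projection gives a crossed module \<open>H\<close> with an equivalence to \<open>G\<close>, because
  the projection is onto and 2-morphisms of \<open>H\<close> are those of \<open>G\<close> between the images. On it
  \<open>(a, x) \<mapsto> a \<omega>\<^sub>2(x)\<close> completes the strict action. The two actions are intertwined by the regular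
  bimodule \<open>A\<close> with \<open>\<omega>\<^sub>M(a, g)(m) = a \<omega>\<^sub>1(g)(m)\<close>, where \<open>A\<degree>\<close> is identified with \<open>A\<close> through
  evaluation at \<open>1\<close> if \<open>g\<close> has degree \<open>-1\<close>.
\<close>

section \<open>The crossed module of generalized automorphisms\<close>

text \<open>Complements \<open>m_assoc\<close> as a rewrite rule: once products are associated to
  the right, an element next to its inverse inside a longer product has this shape.\<close>

lemma (in group) m_inv_cancel [simp]:
  assumes "x \<in> carrier G" "y \<in> carrier G"
  shows "x \<otimes> (inv x \<otimes> y) = y" "inv x \<otimes> (x \<otimes> y) = y"
  using assms by (simp_all add: m_assoc [symmetric])

sublocale assoc_algebra \<subseteq> A: ring A
  by (rule ring)

sublocale assoc_algebra \<subseteq> Mod: module K A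
  by (rule module)

lemma signed_alg_sel [simp]:
  "carrier (signed_alg s A) = carrier A"
  "add (signed_alg s A) = add A"
  "one (signed_alg s A) = one A"
  "smult (signed_alg s A) = smult A"
  "x \<otimes>\<^bsub>signed_alg s A\<^esub> y = (if s = 1 then x \<otimes>\<^bsub>A\<^esub> y else y \<otimes>\<^bsub>A\<^esub> x)"
  by (simp_all add: signed_alg_def opp_def)

lemma AUT_gen_sel [simp]:
  "grp1 (AUT_gen K A) = Aut_gen K A"
  "carrier (grp2 (AUT_gen K A)) = Units A"
  "x \<otimes>\<^bsub>grp2 (AUT_gen K A)\<^esub> y = x \<otimes>\<^bsub>A\<^esub> y"
  "\<one>\<^bsub>grp2 (AUT_gen K A)\<^esub> = \<one>\<^bsub>A\<^esub>"
  "grading (AUT_gen K A) = fst"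
  "bd (AUT_gen K A) y = (1, \<lambda>a\<in>carrier A. y \<otimes>\<^bsub>A\<^esub> a \<otimes>\<^bsub>A\<^esub> inv\<^bsub>A\<^esub> y)"
  "act (AUT_gen K A) g y = snd g (if fst g = 1 then y else inv\<^bsub>A\<^esub> y)"
  by (simp_all add: AUT_gen_def units_of_def case_prod_unfold)

context assoc_algebra
begin

lemma Aut_gen_iff:
  "u \<in> carrier (Aut_gen K A) \<longleftrightarrow>
     fst u \<in> {1, -1} \<and> snd u \<in> extensional (carrier A) \<and> bij_betw (snd u) (carrier A) (carrier A) \<and>
     (\<forall>x\<in>carrier A. \<forall>y\<in>carrier A. snd u (x \<oplus>\<^bsub>A\<^esub> y) = snd u x \<oplus>\<^bsub>A\<^esub> snd u y) \<and>
     (\<forall>k\<in>carrier K. \<forall>x\<in>carrier A. snd u (k \<odot>\<^bsub>A\<^esub> x) = k \<odot>\<^bsub>A\<^esub> snd u x) \<and>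
     snd u \<one>\<^bsub>A\<^esub> = \<one>\<^bsub>A\<^esub> \<and>
     (\<forall>x\<in>carrier A. \<forall>y\<in>carrier A. snd u (x \<otimes>\<^bsub>A\<^esub> y) =
       (if fst u = 1 then snd u x \<otimes>\<^bsub>A\<^esub> snd u y else snd u y \<otimes>\<^bsub>A\<^esub> snd u x))"
  unfolding Aut_gen_def alg_iso_def ring_iso_def ring_hom_def
  by (cases u) (auto simp: bij_betw_def Pi_iff)

lemma
  assumes "u \<in> carrier (Aut_gen K A)"
  shows Aut_gen_cases: "fst u = 1 \<or> fst u = -1"
    and Aut_gen_extensional: "snd u \<in> extensional (carrier A)"
    and Aut_gen_bij: "bij_betw (snd u) (carrier A) (carrier A)"
    and Aut_gen_closed [simp]: "x \<in> carrier A \<Longrightarrow> snd u x \<in> carrier A"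
    and Aut_gen_add: "\<lbrakk>x \<in> carrier A; y \<in> carrier A\<rbrakk> \<Longrightarrow>
      snd u (x \<oplus>\<^bsub>A\<^esub> y) = snd u x \<oplus>\<^bsub>A\<^esub> snd u y"
    and Aut_gen_smult: "\<lbrakk>k \<in> carrier K; x \<in> carrier A\<rbrakk> \<Longrightarrow> snd u (k \<odot>\<^bsub>A\<^esub> x) = k \<odot>\<^bsub>A\<^esub> snd u x"
    and Aut_gen_one [simp]: "snd u \<one>\<^bsub>A\<^esub> = \<one>\<^bsub>A\<^esub>"
    and Aut_gen_mult: "\<lbrakk>x \<in> carrier A; y \<in> carrier A\<rbrakk> \<Longrightarrow> snd u (x \<otimes>\<^bsub>A\<^esub> y) =
       (if fst u = 1 then snd u x \<otimes>\<^bsub>A\<^esub> snd u y else snd u y \<otimes>\<^bsub>A\<^esub> snd u x)"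
  using assms by (auto simp: Aut_gen_iff bij_betw_def)

lemma Aut_gen_eqI:
  assumes "u \<in> carrier (Aut_gen K A)" "v \<in> carrier (Aut_gen K A)" "fst u = fst v"
    and "\<And>x. x \<in> carrier A \<Longrightarrow> snd u x = snd v x"
  shows "u = v"
  using assms Aut_gen_extensional by (metis extensionalityI prod.expand)

lemma Aut_gen_mult_sel [simp]:
  "fst (u \<otimes>\<^bsub>Aut_gen K A\<^esub> v) = fst u * fst v"
  "x \<in> carrier A \<Longrightarrow> snd (u \<otimes>\<^bsub>Aut_gen K A\<^esub> v) x = snd u (snd v x)"
  by (simp_all add: Aut_gen_def case_prod_unfold compose_def)

lemma Aut_gen_one_sel [simp]:
  "fst \<one>\<^bsub>Aut_gen K A\<^esub> = 1"
  "x \<in> carrier A \<Longrightarrow> snd \<one>\<^bsub>Aut_gen K A\<^esub> x = x"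
  by (simp_all add: Aut_gen_def)

lemma Aut_gen_mult_closed:
  assumes u: "u \<in> carrier (Aut_gen K A)" and v: "v \<in> carrier (Aut_gen K A)"
  shows "u \<otimes>\<^bsub>Aut_gen K A\<^esub> v \<in> carrier (Aut_gen K A)"
proof -
  have "bij_betw (snd u \<circ> snd v) (carrier A) (carrier A)"
    using Aut_gen_bij [OF u] Aut_gen_bij [OF v] by (rule bij_betw_trans [rotated])
  then have "bij_betw (snd (u \<otimes>\<^bsub>Aut_gen K A\<^esub> v)) (carrier A) (carrier A)"
    by (rule bij_betw_cong [THEN iffD1, rotated]) simp
  moreover have "snd (u \<otimes>\<^bsub>Aut_gen K A\<^esub> v) \<in> extensional (carrier A)"
    by (simp add: Aut_gen_def case_prod_unfold)
  ultimately show ?thesis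
    unfolding Aut_gen_iff [of "u \<otimes>\<^bsub>Aut_gen K A\<^esub> v"]
    using u v Aut_gen_cases [OF u] Aut_gen_cases [OF v]
    by (elim disjE) (simp_all add: Aut_gen_add Aut_gen_smult Aut_gen_mult)
qed

lemma Aut_gen_group: "group (Aut_gen K A)"
proof (rule groupI)
  show one: "\<one>\<^bsub>Aut_gen K A\<^esub> \<in> carrier (Aut_gen K A)"
    by (simp add: Aut_gen_iff) (simp add: Aut_gen_def bij_betw_def inj_on_def)
  fix u assume u: "u \<in> carrier (Aut_gen K A)"
  show "\<one>\<^bsub>Aut_gen K A\<^esub> \<otimes>\<^bsub>Aut_gen K A\<^esub> u = u"
    by (rule Aut_gen_eqI) (simp_all add: u one Aut_gen_mult_closed)
  \<comment> \<open>The degree is its own inverse in \<open>{1, -1}\<close>. The restriction makes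
    the inverse map extensional, as elements of \<open>Aut_gen\<close> have to be.\<close>
  define v where "v = (fst u, \<lambda>a\<in>carrier A. inv_into (carrier A) (snd u) a)"
  have bij: "bij_betw (inv_into (carrier A) (snd u)) (carrier A) (carrier A)"
    using Aut_gen_bij [OF u] by (rule bij_betw_inv_into)
  have v_closed: "snd v x \<in> carrier A" if "x \<in> carrier A" for x
    using bij that by (auto simp: v_def bij_betw_def)
  have uv: "snd u (snd v x) = x" if "x \<in> carrier A" for x
    using that Aut_gen_bij [OF u] by (simp add: v_def bij_betw_inv_into_right)
  have vu: "snd v (snd u x) = x" if "x \<in> carrier A" for x
    using that Aut_gen_bij [OF u] u by (simp add: v_def bij_betw_inv_into_left)
  \<comment> \<open>An equation about \<open>snd v\<close> is settled by applying
    \<open>snd u\<close> to the claimed value, so each law for \<open>u\<close> yields the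
    corresponding law for \<open>v\<close>.\<close>
  have v_unique: "snd v y = x" if "x \<in> carrier A" "y = snd u x" for x y
    using that vu by simp
  have v: "v \<in> carrier (Aut_gen K A)"
    unfolding Aut_gen_iff
  proof (intro conjI ballI)
    show "fst v \<in> {1, -1}"
      using Aut_gen_cases [OF u] by (simp add: v_def)
    show "bij_betw (snd v) (carrier A) (carrier A)"
      using bij by (rule bij_betw_cong [THEN iffD1, rotated]) (simp add: v_def)
  qed (use u in \<open>auto intro!: v_unique simp: v_closed uv Aut_gen_add Aut_gen_smult Aut_gen_mult,
       auto simp: v_def\<close>)
  then show "\<exists>v\<in>carrier (Aut_gen K A). v \<otimes>\<^bsub>Aut_gen K A\<^esub> u = \<one>\<^bsub>Aut_gen K A\<^esub>"
    using Aut_gen_cases [OF u]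
    by (intro bexI [of _ v] Aut_gen_eqI) (auto simp: u one vu Aut_gen_mult_closed, auto simp: v_def)
next
  fix u v w
  assume "u \<in> carrier (Aut_gen K A)" "v \<in> carrier (Aut_gen K A)" "w \<in> carrier (Aut_gen K A)"
  then show "u \<otimes>\<^bsub>Aut_gen K A\<^esub> v \<otimes>\<^bsub>Aut_gen K A\<^esub> w = u \<otimes>\<^bsub>Aut_gen K A\<^esub> (v \<otimes>\<^bsub>Aut_gen K A\<^esub> w)"
    by (intro Aut_gen_eqI) (simp_all add: Aut_gen_mult_closed)
qed (rule Aut_gen_mult_closed)

section \<open>Units, inner automorphisms and the crossed module axioms\<close>

declare A.Units_closed [simp]

lemma units_cancel [simp]:
  assumes "y \<in> Units A" "x \<in> carrier A"
  shows "y \<otimes>\<^bsub>A\<^esub> (inv\<^bsub>A\<^esub> y \<otimes>\<^bsub>A\<^esub> x) = x" "inv\<^bsub>A\<^esub> y \<otimes>\<^bsub>A\<^esub> (y \<otimes>\<^bsub>A\<^esub> x) = x"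
  using assms by (simp_all add: A.m_assoc [symmetric])

lemma units_inv_mult:
  assumes "x \<in> Units A" "y \<in> Units A"
  shows "inv\<^bsub>A\<^esub> (x \<otimes>\<^bsub>A\<^esub> y) = inv\<^bsub>A\<^esub> y \<otimes>\<^bsub>A\<^esub> inv\<^bsub>A\<^esub> x"
  using assms by (intro A.inv_unique' [symmetric]) (simp_all add: A.m_assoc)

lemma AUT_gen_inv: "y \<in> Units A \<Longrightarrow> inv\<^bsub>grp2 (AUT_gen K A)\<^esub> y = inv\<^bsub>A\<^esub> y"
  by (simp add: AUT_gen_def A.units_of_inv)

lemma inner_in_Aut_gen:
  assumes y: "y \<in> Units A"
  shows "bd (AUT_gen K A) y \<in> carrier (Aut_gen K A)"
proof -
  have "bij_betw (\<lambda>a\<in>carrier A. y \<otimes>\<^bsub>A\<^esub> a \<otimes>\<^bsub>A\<^esub> inv\<^bsub>A\<^esub> y) (carrier A) (carrier A)"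
    by (rule bij_betw_byWitness [where f' = "\<lambda>a. inv\<^bsub>A\<^esub> y \<otimes>\<^bsub>A\<^esub> a \<otimes>\<^bsub>A\<^esub> y"])
      (use y in \<open>auto simp: A.m_assoc\<close>)
  then show ?thesis
    using y by (simp add: Aut_gen_iff A.m_assoc A.r_distr A.l_distr smult_mult_left smult_mult_right)
qed

text \<open>An antiautomorphism merely exchanges the two equations that characterize the inverse of
  a unit, so inverses are preserved in both degrees.\<close>

lemma
  assumes u: "u \<in> carrier (Aut_gen K A)" and y: "y \<in> Units A"
  shows Aut_gen_Units [simp]: "snd u y \<in> Units A"
    and Aut_gen_inv: "snd u (inv\<^bsub>A\<^esub> y) = inv\<^bsub>A\<^esub> (snd u y)"
proof -
  have *: "snd u y \<otimes>\<^bsub>A\<^esub> snd u (inv\<^bsub>A\<^esub> y) = \<one>\<^bsub>A\<^esub>" "snd u (inv\<^bsub>A\<^esub> y) \<otimes>\<^bsub>A\<^esub> snd u y = \<one>\<^bsub>A\<^esub>"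
    using u y Aut_gen_mult [OF u, of y "inv\<^bsub>A\<^esub> y"] Aut_gen_mult [OF u, of "inv\<^bsub>A\<^esub> y" y]
    by (cases "fst u = 1"; simp)+
  then show "snd u y \<in> Units A"
    using u y Aut_gen_closed [OF u A.Units_inv_closed [OF y]]
    by (subst Units_def) auto
  show "snd u (inv\<^bsub>A\<^esub> y) = inv\<^bsub>A\<^esub> (snd u y)"
    using u y * by (intro A.inv_unique') simp_all
qed

theorem AUT_gen_graded_crossed_module: "graded_crossed_module (AUT_gen K A)"
proof (rule graded_crossed_module.intro)
  show "group (grp1 (AUT_gen K A))"
    by (simp add: Aut_gen_group)
  show "group (grp2 (AUT_gen K A))"
    using A.units_group by (simp add: AUT_gen_def)
  show "bd (AUT_gen K A) \<in> hom (grp2 (AUT_gen K A)) (grp1 (AUT_gen K A))"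
    using inner_in_Aut_gen
    by (auto simp: hom_def simp del: AUT_gen_sel(6) intro!: Aut_gen_eqI Aut_gen_mult_closed)
      (simp_all add: A.m_assoc units_inv_mult)
  show "grading (AUT_gen K A) \<in> hom (grp1 (AUT_gen K A)) sign_img"
    using Aut_gen_cases by (auto simp: hom_def sign_img_def)
next
  fix u assume "u \<in> carrier (grp1 (AUT_gen K A))"
  \<comment> \<open>In degree -1 both inversion and \<open>snd u\<close> reverse products, so their
    composite preserves them.\<close>
  then show "act (AUT_gen K A) u \<in> hom (grp2 (AUT_gen K A)) (grp2 (AUT_gen K A))"
    by (auto simp: hom_def Aut_gen_mult units_inv_mult)
next
  fix u v x
  assume "u \<in> carrier (grp1 (AUT_gen K A))" "v \<in> carrier (grp1 (AUT_gen K A))"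
    "x \<in> carrier (grp2 (AUT_gen K A))"
  \<comment> \<open>Inversion commutes with maps of either degree, so the inversions coming from two
    factors of degree -1 cancel.\<close>
  then show "act (AUT_gen K A) (u \<otimes>\<^bsub>grp1 (AUT_gen K A)\<^esub> v) x =
      act (AUT_gen K A) u (act (AUT_gen K A) v x)"
    using Aut_gen_cases [of u] Aut_gen_cases [of v] by (auto simp: Aut_gen_inv)
next
  interpret group "Aut_gen K A" by (rule Aut_gen_group)
  fix u y assume "u \<in> carrier (grp1 (AUT_gen K A))" and y: "y \<in> carrier (grp2 (AUT_gen K A))"
  then have u: "u \<in> carrier (Aut_gen K A)" and y: "y \<in> Units A" by simp_all
  let ?uy = "act (AUT_gen K A) u y"
  have uy: "?uy \<in> Units A"
    using u y by simp
  \<comment> \<open>Equivariance is checked after multiplying by \<open>u\<close> on the right. Both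
    sides can then be evaluated at points of \<open>A\<close> without describing the inverse of
    \<open>u\<close>.\<close>
  have "bd (AUT_gen K A) ?uy \<otimes>\<^bsub>Aut_gen K A\<^esub> u = u \<otimes>\<^bsub>Aut_gen K A\<^esub> bd (AUT_gen K A) y"
  proof (rule Aut_gen_eqI)
    fix x assume "x \<in> carrier A"
    then show "snd (bd (AUT_gen K A) ?uy \<otimes>\<^bsub>Aut_gen K A\<^esub> u) x = snd (u \<otimes>\<^bsub>Aut_gen K A\<^esub> bd (AUT_gen K A) y) x"
      using u y Aut_gen_cases [OF u] by (auto simp: Aut_gen_mult Aut_gen_inv A.m_assoc)
  qed (use u y uy inner_in_Aut_gen in \<open>simp_all del: AUT_gen_sel(6,7) add: Aut_gen_mult_closed\<close>, simp)
  then show "bd (AUT_gen K A) ?uy = u \<otimes>\<^bsub>grp1 (AUT_gen K A)\<^esub> bd (AUT_gen K A) y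
      \<otimes>\<^bsub>grp1 (AUT_gen K A)\<^esub> inv\<^bsub>grp1 (AUT_gen K A)\<^esub> u"
    using u y uy inner_in_Aut_gen by (simp del: AUT_gen_sel(6,7) add: inv_solve_right)
qed (simp_all add: AUT_gen_inv)

end


section \<open>Strictification of weak homomorphisms\<close>

sublocale graded_crossed_module \<subseteq> grp1: group "grp1 G"
  by (rule group1)

sublocale graded_crossed_module \<subseteq> grp2: group "grp2 G"
  by (rule group2)

sublocale graded_crossed_module \<subseteq> bd: group_hom "grp2 G" "grp1 G" "bd G"
  by unfold_locales (rule bd_hom)

context graded_crossed_module
begin

lemma act_group_hom: "g \<in> carrier (grp1 G) \<Longrightarrow> group_hom (grp2 G) (grp2 G) (act G g)"
  by unfold_locales (rule act_hom)

lemma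
  assumes g: "g \<in> carrier (grp1 G)" and x: "x \<in> carrier (grp2 G)"
  shows act_closed [simp]: "act G g x \<in> carrier (grp2 G)"
    and act_mult_right: "y \<in> carrier (grp2 G) \<Longrightarrow>
      act G g (x \<otimes>\<^bsub>grp2 G\<^esub> y) = act G g x \<otimes>\<^bsub>grp2 G\<^esub> act G g y"
    and act_inv_right: "act G g (inv\<^bsub>grp2 G\<^esub> x) = inv\<^bsub>grp2 G\<^esub> (act G g x)"
proof -
  interpret group_hom "grp2 G" "grp2 G" "act G g"
    using g by (rule act_group_hom)
  show "act G g x \<in> carrier (grp2 G)" "act G g (inv\<^bsub>grp2 G\<^esub> x) = inv\<^bsub>grp2 G\<^esub> (act G g x)"
    using x by simp_all
  show "y \<in> carrier (grp2 G) \<Longrightarrow> act G g (x \<otimes>\<^bsub>grp2 G\<^esub> y) = act G g x \<otimes>\<^bsub>grp2 G\<^esub> act G g y"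
    using x by simp
qed

lemma act_one_right [simp]: "g \<in> carrier (grp1 G) \<Longrightarrow> act G g \<one>\<^bsub>grp2 G\<^esub> = \<one>\<^bsub>grp2 G\<^esub>"
  using act_group_hom by (rule group_hom.hom_one)

lemma grading_mult:
  "\<lbrakk>g \<in> carrier (grp1 G); h \<in> carrier (grp1 G)\<rbrakk> \<Longrightarrow>
    grading G (g \<otimes>\<^bsub>grp1 G\<^esub> h) = grading G g * grading G h"
  using hom_mult [OF grading_hom] by (simp add: sign_img_def)

lemma grading_cases: "g \<in> carrier (grp1 G) \<Longrightarrow> grading G g = 1 \<or> grading G g = -1"
  using hom_in_carrier [OF grading_hom] by (auto simp: sign_img_def)

end

text \<open>The N-weak axioms with an arbitrary graded crossed module \<open>B\<close> in place of
  \<open>AUT_gen K A\<close>: the strictification uses only the crossed module structure of the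
  target. The algebra itself returns with the intertwining bimodule.\<close>

locale weak_hom = G: graded_crossed_module G + B: graded_crossed_module B
  for G :: "('g, 'x) crossed_module" and B :: "('h, 'u) crossed_module" +
  fixes w1 :: "'g \<Rightarrow> 'h" and w2 :: "'x \<Rightarrow> 'u" and w3 :: "'g \<Rightarrow> 'g \<Rightarrow> 'u"
  assumes w1_closed [simp]: "g \<in> carrier (grp1 G) \<Longrightarrow> w1 g \<in> carrier (grp1 B)"
    and w1_grading [simp]: "g \<in> carrier (grp1 G) \<Longrightarrow> grading B (w1 g) = grading G g"
    and w1_one [simp]: "w1 \<one>\<^bsub>grp1 G\<^esub> = \<one>\<^bsub>grp1 B\<^esub>"
    and w2_closed [simp]: "x \<in> carrier (grp2 G) \<Longrightarrow> w2 x \<in> carrier (grp2 B)"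
    and w2_one [simp]: "w2 \<one>\<^bsub>grp2 G\<^esub> = \<one>\<^bsub>grp2 B\<^esub>"
    and w3_closed [simp]:
      "\<lbrakk>g \<in> carrier (grp1 G); h \<in> carrier (grp1 G)\<rbrakk> \<Longrightarrow> w3 g h \<in> carrier (grp2 B)"
    and w3_one_left [simp]: "g \<in> carrier (grp1 G) \<Longrightarrow> w3 \<one>\<^bsub>grp1 G\<^esub> g = \<one>\<^bsub>grp2 B\<^esub>"
    and w3_one_right [simp]: "g \<in> carrier (grp1 G) \<Longrightarrow> w3 g \<one>\<^bsub>grp1 G\<^esub> = \<one>\<^bsub>grp2 B\<^esub>"
    and w1_mult: "\<lbrakk>g \<in> carrier (grp1 G); h \<in> carrier (grp1 G)\<rbrakk> \<Longrightarrow>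
      w1 (g \<otimes>\<^bsub>grp1 G\<^esub> h) = bd B (w3 g h) \<otimes>\<^bsub>grp1 B\<^esub> w1 g \<otimes>\<^bsub>grp1 B\<^esub> w1 h"
    and w2_mult: "\<lbrakk>x \<in> carrier (grp2 G); y \<in> carrier (grp2 G)\<rbrakk> \<Longrightarrow>
      w2 (x \<otimes>\<^bsub>grp2 G\<^esub> y) = w3 (bd G x) (bd G y) \<otimes>\<^bsub>grp2 B\<^esub> w2 x \<otimes>\<^bsub>grp2 B\<^esub> w2 y"
    and w1_bd [simp]: "x \<in> carrier (grp2 G) \<Longrightarrow> w1 (bd G x) = bd B (w2 x)"
    and w3_cocycle:
      "\<lbrakk>g \<in> carrier (grp1 G); h \<in> carrier (grp1 G); k \<in> carrier (grp1 G)\<rbrakk> \<Longrightarrow>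
      w3 (g \<otimes>\<^bsub>grp1 G\<^esub> h) k \<otimes>\<^bsub>grp2 B\<^esub> w3 g h =
        w3 g (h \<otimes>\<^bsub>grp1 G\<^esub> k) \<otimes>\<^bsub>grp2 B\<^esub> act B (w1 g) (w3 h k)"
    and w2_act: "\<lbrakk>g \<in> carrier (grp1 G); x \<in> carrier (grp2 G)\<rbrakk> \<Longrightarrow>
      w2 (act G g x) =
        w3 (g \<otimes>\<^bsub>grp1 G\<^esub> bd G x) (inv\<^bsub>grp1 G\<^esub> g) \<otimes>\<^bsub>grp2 B\<^esub> w3 g (bd G x)
          \<otimes>\<^bsub>grp2 B\<^esub> act B (w1 g) (w2 x) \<otimes>\<^bsub>grp2 B\<^esub> inv\<^bsub>grp2 B\<^esub> (w3 g (inv\<^bsub>grp1 G\<^esub> g))"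
begin

text \<open>
  The pair \<open>(a, g)\<close> stands for \<open>g\<close> together with the 2-morphism \<open>a : w1 g \<Rightarrow> \<partial>(a) w1 g\<close>;
  the product is the one which makes \<open>(a, g) \<mapsto> \<partial>(a) w1 g\<close> a homomorphism. \<open>strictification2\<close> is
  the pullback of \<open>snd : strictification1 \<rightarrow> grp1 G\<close> along \<open>bd G\<close>: \<open>(a, x)\<close> encodes
  \<open>((a, \<partial>x), x)\<close>.
\<close>

definition strictification1 :: "('u \<times> 'g) monoid" where
  "strictification1 =
    \<lparr>carrier = carrier (grp2 B) \<times> carrier (grp1 G),
     monoid.mult = (\<lambda>(a, g) (b, h).
       (a \<otimes>\<^bsub>grp2 B\<^esub> act B (w1 g) b \<otimes>\<^bsub>grp2 B\<^esub> inv\<^bsub>grp2 B\<^esub> (w3 g h), g \<otimes>\<^bsub>grp1 G\<^esub> h)),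
     one = (\<one>\<^bsub>grp2 B\<^esub>, \<one>\<^bsub>grp1 G\<^esub>)\<rparr>"

definition strictification_bd :: "'u \<times> 'x \<Rightarrow> 'u \<times> 'g" where
  "strictification_bd = map_prod id (bd G)"

definition strictification2 :: "('u \<times> 'x) monoid" where
  "strictification2 =
    \<lparr>carrier = carrier (grp2 B) \<times> carrier (grp2 G),
     monoid.mult = (\<lambda>y z.
       (fst (strictification_bd y \<otimes>\<^bsub>strictification1\<^esub> strictification_bd z), snd y \<otimes>\<^bsub>grp2 G\<^esub> snd z)),
     one = (\<one>\<^bsub>grp2 B\<^esub>, \<one>\<^bsub>grp2 G\<^esub>)\<rparr>"

definition strictification :: "('u \<times> 'g, 'u \<times> 'x) crossed_module" where
  "strictification =
    \<lparr>grp1 = strictification1,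
     grp2 = strictification2,
     bd = strictification_bd,
     act = (\<lambda>h y. (fst (h \<otimes>\<^bsub>strictification1\<^esub> strictification_bd y
       \<otimes>\<^bsub>strictification1\<^esub> inv\<^bsub>strictification1\<^esub> h), act G (snd h) (snd y))),
     grading = grading G \<circ> snd\<rparr>"

definition strict1 :: "'u \<times> 'g \<Rightarrow> 'h" where
  "strict1 h = bd B (fst h) \<otimes>\<^bsub>grp1 B\<^esub> w1 (snd h)"

definition strict2 :: "'u \<times> 'x \<Rightarrow> 'u" where
  "strict2 y = fst y \<otimes>\<^bsub>grp2 B\<^esub> w2 (snd y)"

lemma strictification1_sel [simp]:
  "carrier strictification1 = carrier (grp2 B) \<times> carrier (grp1 G)"
  "\<one>\<^bsub>strictification1\<^esub> = (\<one>\<^bsub>grp2 B\<^esub>, \<one>\<^bsub>grp1 G\<^esub>)"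
  "fst (h \<otimes>\<^bsub>strictification1\<^esub> k) =
    fst h \<otimes>\<^bsub>grp2 B\<^esub> act B (w1 (snd h)) (fst k) \<otimes>\<^bsub>grp2 B\<^esub> inv\<^bsub>grp2 B\<^esub> (w3 (snd h) (snd k))"
  "snd (h \<otimes>\<^bsub>strictification1\<^esub> k) = snd h \<otimes>\<^bsub>grp1 G\<^esub> snd k"
  by (simp_all add: strictification1_def case_prod_unfold)

lemma strictification_bd_sel [simp]:
  "fst (strictification_bd y) = fst y"
  "snd (strictification_bd y) = bd G (snd y)"
  by (simp_all add: strictification_bd_def)

lemma strictification2_sel [simp]:
  "carrier strictification2 = carrier (grp2 B) \<times> carrier (grp2 G)"
  "\<one>\<^bsub>strictification2\<^esub> = (\<one>\<^bsub>grp2 B\<^esub>, \<one>\<^bsub>grp2 G\<^esub>)"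
  "fst (y \<otimes>\<^bsub>strictification2\<^esub> z) =
    fst (strictification_bd y \<otimes>\<^bsub>strictification1\<^esub> strictification_bd z)"
  "snd (y \<otimes>\<^bsub>strictification2\<^esub> z) = snd y \<otimes>\<^bsub>grp2 G\<^esub> snd z"
  by (simp_all add: strictification2_def)

text \<open>\<open>w1\<close> is multiplicative up to the boundary of \<open>w3 g h\<close>, and by
  the Peiffer identity a boundary acts by conjugation.\<close>

lemma act_w1_mult:
  assumes "g \<in> carrier (grp1 G)" "h \<in> carrier (grp1 G)" "a \<in> carrier (grp2 B)"
  shows "act B (w1 (g \<otimes>\<^bsub>grp1 G\<^esub> h)) a =
    w3 g h \<otimes>\<^bsub>grp2 B\<^esub> act B (w1 g) (act B (w1 h) a) \<otimes>\<^bsub>grp2 B\<^esub> inv\<^bsub>grp2 B\<^esub> (w3 g h)"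
  using assms by (simp add: w1_mult B.act_mult B.peiffer B.grp1.m_assoc)

text \<open>The product of \<open>strictification1\<close> contains inverses of \<open>w3\<close>,
  so associativity needs the cocycle identity in inverted form.\<close>

lemma w3_cocycle_inv:
  assumes "g \<in> carrier (grp1 G)" "h \<in> carrier (grp1 G)" "k \<in> carrier (grp1 G)"
  shows "inv\<^bsub>grp2 B\<^esub> (w3 g h) \<otimes>\<^bsub>grp2 B\<^esub> inv\<^bsub>grp2 B\<^esub> (w3 (g \<otimes>\<^bsub>grp1 G\<^esub> h) k) =
    inv\<^bsub>grp2 B\<^esub> (act B (w1 g) (w3 h k)) \<otimes>\<^bsub>grp2 B\<^esub> inv\<^bsub>grp2 B\<^esub> (w3 g (h \<otimes>\<^bsub>grp1 G\<^esub> k))"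
  using assms w3_cocycle [of g h k] by (simp flip: B.grp2.inv_mult_group)

text \<open>In a triple product, the conjugation by \<open>w3\<close> from
  \<open>act_w1_mult\<close> cancels against the correction of the inner product; what remains of
  associativity is the inverted cocycle identity.\<close>

lemma strictification1_group: "group strictification1"
proof (rule groupI)
  fix h k l
  assume hkl: "h \<in> carrier strictification1" "k \<in> carrier strictification1" "l \<in> carrier strictification1"
  show "h \<otimes>\<^bsub>strictification1\<^esub> k \<otimes>\<^bsub>strictification1\<^esub> l =
      h \<otimes>\<^bsub>strictification1\<^esub> (k \<otimes>\<^bsub>strictification1\<^esub> l)"
    using hkl w3_cocycle_inv [of "snd h" "snd k" "snd l"]
    by (intro prod_eqI)
      (auto simp: act_w1_mult B.act_mult_right B.act_inv_right B.grp2.m_assoc G.grp1.m_assoc)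
next
  fix h assume h: "h \<in> carrier strictification1"
  \<comment> \<open>Found by solving for the first component in the equation that the product of
    \<open>?k\<close> and \<open>h\<close> is the unit.\<close>
  let ?k = "(w3 (inv\<^bsub>grp1 G\<^esub> (snd h)) (snd h) \<otimes>\<^bsub>grp2 B\<^esub>
    inv\<^bsub>grp2 B\<^esub> (act B (w1 (inv\<^bsub>grp1 G\<^esub> (snd h))) (fst h)), inv\<^bsub>grp1 G\<^esub> (snd h))"
  show "\<exists>k\<in>carrier strictification1. k \<otimes>\<^bsub>strictification1\<^esub> h = \<one>\<^bsub>strictification1\<^esub>"
    using h by (intro bexI [of _ ?k] prod_eqI) (auto simp: B.grp2.m_assoc)
qed (auto simp: mem_Times_iff B.act_one intro!: prod_eqI)

interpretation S1: group strictification1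
  by (rule strictification1_group)

lemma snd_hom: "snd \<in> hom strictification1 (grp1 G)"
  by (auto simp: hom_def)

interpretation snd: group_hom strictification1 "grp1 G" snd
  by unfold_locales (rule snd_hom)

section \<open>The pullback group \<open>strictification2\<close>\<close>

lemma strictification_bd_closed [simp]:
  "y \<in> carrier strictification2 \<Longrightarrow> strictification_bd y \<in> carrier strictification1"
  by (cases y) (simp add: strictification_bd_def)

lemma strictification_bd_mult [simp]:
  assumes "y \<in> carrier strictification2" "z \<in> carrier strictification2"
  shows "strictification_bd (y \<otimes>\<^bsub>strictification2\<^esub> z) =
    strictification_bd y \<otimes>\<^bsub>strictification1\<^esub> strictification_bd z"
  using assms by (intro prod_eqI) auto

text \<open>The two projections of the pullback are jointly injective. The laws below are therefore
  checked in \<open>strictification1\<close> and in \<open>grp2 G\<close> separately.\<close>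

lemma strictification2_eqI:
  assumes "strictification_bd y = strictification_bd z" "snd y = snd z"
  shows "y = z"
  using assms by (metis prod_eqI strictification_bd_sel(1))

text \<open>Existence in the pullback property: compatible \<open>h\<close> and \<open>x\<close>
  come from a common element.\<close>

lemma strictification_bd_lift [simp]:
  assumes "x \<in> carrier (grp2 G)" "snd h = bd G x"
  shows "strictification_bd (fst h, x) = h"
  using assms by (simp add: prod_eq_iff)

lemma strictification2_mult_closed [simp]:
  "\<lbrakk>y \<in> carrier strictification2; z \<in> carrier strictification2\<rbrakk> \<Longrightarrow>
    y \<otimes>\<^bsub>strictification2\<^esub> z \<in> carrier strictification2"
  using S1.m_closed [OF strictification_bd_closed strictification_bd_closed, of y z]
  by (auto simp: mem_Times_iff)

lemma strictification2_group: "group strictification2"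
proof (rule groupI)
  fix y assume y: "y \<in> carrier strictification2"
  \<comment> \<open>The inverse is taken under each projection; since \<open>snd\<close> and
    \<open>bd G\<close> are homomorphisms, the two results are compatible.\<close>
  let ?z = "(fst (inv\<^bsub>strictification1\<^esub> (strictification_bd y)), inv\<^bsub>grp2 G\<^esub> (snd y))"
  have z: "?z \<in> carrier strictification2"
    using y S1.inv_closed [OF strictification_bd_closed [OF y]] by (auto simp: mem_Times_iff)
  have "snd (inv\<^bsub>strictification1\<^esub> (strictification_bd y)) = bd G (inv\<^bsub>grp2 G\<^esub> (snd y))"
    using snd.hom_inv [OF strictification_bd_closed [OF y]] y by auto
  then have bd_z: "strictification_bd ?z = inv\<^bsub>strictification1\<^esub> (strictification_bd y)"
    using y by (intro strictification_bd_lift) auto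
  have "strictification_bd (?z \<otimes>\<^bsub>strictification2\<^esub> y) = strictification_bd \<one>\<^bsub>strictification2\<^esub>"
    using y z by (simp add: bd_z del: strictification1_sel strictification2_sel)
      (simp add: prod_eq_iff)
  then have "?z \<otimes>\<^bsub>strictification2\<^esub> y = \<one>\<^bsub>strictification2\<^esub>"
    using y by (intro strictification2_eqI) auto
  with z show "\<exists>z\<in>carrier strictification2. z \<otimes>\<^bsub>strictification2\<^esub> y = \<one>\<^bsub>strictification2\<^esub>"
    by blast
next
  fix x y z
  assume "x \<in> carrier strictification2" "y \<in> carrier strictification2" "z \<in> carrier strictification2"
  then show "x \<otimes>\<^bsub>strictification2\<^esub> y \<otimes>\<^bsub>strictification2\<^esub> z =
      x \<otimes>\<^bsub>strictification2\<^esub> (y \<otimes>\<^bsub>strictification2\<^esub> z)"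
    by (intro strictification2_eqI)
      (simp_all add: S1.m_assoc del: strictification1_sel strictification2_sel(1-3),
       auto simp: G.grp2.m_assoc)
qed (auto intro!: strictification2_mult_closed prod_eqI simp: mem_Times_iff B.act_one
     simp del: strictification2_sel(1), auto simp: B.act_one)

section \<open>The strictified crossed module\<close>

lemma strictification_sel [simp]:
  "grp1 strictification = strictification1"
  "grp2 strictification = strictification2"
  "bd strictification = strictification_bd"
  "snd (act strictification h y) = act G (snd h) (snd y)"
  "grading strictification h = grading G (snd h)"
  by (simp_all add: strictification_def)

text \<open>Equivariance in \<open>G\<close> says that the conjugate in
  \<open>strictification1\<close> and the result of \<open>act G\<close> have the same image in
  \<open>grp1 G\<close>, so they fit together to an element of the pullback.\<close>

lemma strictification_bd_act [simp]:
  assumes "h \<in> carrier strictification1" "y \<in> carrier strictification2"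
  shows "strictification_bd (act strictification h y) =
    h \<otimes>\<^bsub>strictification1\<^esub> strictification_bd y \<otimes>\<^bsub>strictification1\<^esub> inv\<^bsub>strictification1\<^esub> h"
  unfolding strictification_def crossed_module.simps
  using assms by (intro strictification_bd_lift) (auto simp: G.equivariance snd.hom_inv)

lemma strictification_act_closed:
  assumes "h \<in> carrier strictification1" "y \<in> carrier strictification2"
  shows "act strictification h y \<in> carrier strictification2"
proof -
  have "strictification_bd (act strictification h y) \<in> carrier strictification1"
    using assms by (simp del: strictification1_sel strictification2_sel)
  then have "fst (act strictification h y) \<in> carrier (grp2 B)"
    by (auto simp: mem_Times_iff)
  with assms show ?thesis
    by (auto simp: mem_Times_iff)
qed

text \<open>Under the projection to \<open>strictification1\<close> the action is conjugation, where
  the axioms are group laws; under the projection to \<open>grp2 G\<close> they are the axioms of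
  \<open>G\<close>.\<close>

theorem strictification_graded_crossed_module: "graded_crossed_module strictification"
proof (rule graded_crossed_module.intro)
  interpret S2: group strictification2
    by (rule strictification2_group)
  interpret bd: group_hom strictification2 strictification1 strictification_bd
    by unfold_locales (simp add: hom_def del: strictification1_sel strictification2_sel)
  \<comment> \<open>Products now stay folded, so that the group laws of \<open>S1\<close> and
    \<open>S2\<close> apply and no \<open>w3\<close> is exposed.\<close>
  note [simp del] = strictification1_sel(1,2,3) strictification2_sel(1,2,3)
  have snd_in [simp]: "snd h \<in> carrier (grp1 G)" if "h \<in> carrier strictification1" for h
    using that by (simp add: strictification1_sel mem_Times_iff)
  have snd_in2 [simp]: "snd y \<in> carrier (grp2 G)" if "y \<in> carrier strictification2" for y
    using that by (simp add: strictification2_sel mem_Times_iff)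
  have snd_inv [simp]: "snd (inv\<^bsub>strictification2\<^esub> y) = inv\<^bsub>grp2 G\<^esub> (snd y)"
    if "y \<in> carrier strictification2" for y
  proof -
    interpret snd2: group_hom strictification2 "grp2 G" snd
      by unfold_locales (simp add: hom_def)
    show ?thesis
      using that by (rule snd2.hom_inv)
  qed
  show "group (grp1 strictification)" "group (grp2 strictification)"
    using strictification1_group strictification2_group by simp_all
  show "bd strictification \<in> hom (grp2 strictification) (grp1 strictification)"
    using bd.homh by simp
  show "grading strictification \<in> hom (grp1 strictification) sign_img"
    unfolding hom_def
    by (intro CollectI conjI funcsetI ballI)
      (use G.grading_cases [OF snd_in] in \<open>simp_all add: sign_img_def G.grading_mult disj_commute\<close>)
  show "grading strictification (bd strictification y) = 1"
    if "y \<in> carrier (grp2 strictification)" for y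
    using that by (simp add: G.grading_bd)
  show "act strictification \<one>\<^bsub>grp1 strictification\<^esub> y = y"
    if "y \<in> carrier (grp2 strictification)" for y
    using that by (intro strictification2_eqI) (simp_all, simp add: strictification1_sel G.act_one)
  show "act strictification (bd strictification z) y =
      z \<otimes>\<^bsub>grp2 strictification\<^esub> y \<otimes>\<^bsub>grp2 strictification\<^esub> inv\<^bsub>grp2 strictification\<^esub> z"
    if "y \<in> carrier (grp2 strictification)" "z \<in> carrier (grp2 strictification)" for y z
    using that by (intro strictification2_eqI) (simp_all add: G.peiffer bd.hom_inv)
  fix h assume "h \<in> carrier (grp1 strictification)"
  then have h: "h \<in> carrier strictification1" by simp
  show "act strictification h \<in> hom (grp2 strictification) (grp2 strictification)"
    unfolding hom_def using h
    by (intro CollectI conjI ballI funcsetI strictification2_eqI)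
      (simp_all add: strictification_act_closed S1.m_assoc G.act_mult_right)
  fix y assume "y \<in> carrier (grp2 strictification)"
  then have y: "y \<in> carrier strictification2" by simp
  show "bd strictification (act strictification h y) =
      h \<otimes>\<^bsub>grp1 strictification\<^esub> bd strictification y \<otimes>\<^bsub>grp1 strictification\<^esub> inv\<^bsub>grp1 strictification\<^esub> h"
    using h y by simp
  show "act strictification (h \<otimes>\<^bsub>grp1 strictification\<^esub> k) y = act strictification h (act strictification k y)"
    if "k \<in> carrier (grp1 strictification)" for k
    using h y that
    by (intro strictification2_eqI)
      (simp_all add: strictification_act_closed S1.m_assoc S1.inv_mult_group G.act_mult)
qed

section \<open>The strict homomorphisms out of the strictification\<close>

lemma strict_hom_snd: "strict_hom strictification G snd snd"
  by (auto simp: strict_hom_def hom_def)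

text \<open>The inverse of \<open>w3\<close> in the twisted product cancels the \<open>w3\<close> of
  \<open>w1_mult\<close> and \<open>w2_mult\<close>. Multiplicativity then rests on equivariance for
  \<open>strict1\<close> and on the Peiffer identity for \<open>strict2\<close>.\<close>

theorem strict_hom_strict: "strict_hom strictification B strict1 strict2"
  unfolding strict_hom_def
proof (intro conjI ballI)
  show "strict1 \<in> hom (grp1 strictification) (grp1 B)"
    by (auto simp: hom_def strict1_def w1_mult B.equivariance B.grp1.m_assoc)
  show "strict2 \<in> hom (grp2 strictification) (grp2 B)"
    by (auto simp: hom_def strict2_def w2_mult B.peiffer B.grp2.m_assoc)
next
  fix y assume "y \<in> carrier (grp2 strictification)"
  then show "strict1 (bd strictification y) = bd B (strict2 y)"
    by (auto simp: strict1_def strict2_def)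
next
  fix h assume "h \<in> carrier (grp1 strictification)"
  then show "grading B (strict1 h) = grading strictification h"
    by (auto simp: strict1_def B.grading_mult B.grading_bd)
next
  fix h y assume "h \<in> carrier (grp1 strictification)" and "y \<in> carrier (grp2 strictification)"
  then have h: "h \<in> carrier strictification1" and y: "y \<in> carrier strictification2" by simp_all
  then obtain a g b x where [simp]: "h = (a, g)" "y = (b, x)"
    and [simp]: "a \<in> carrier (grp2 B)" "g \<in> carrier (grp1 G)" "b \<in> carrier (grp2 B)" "x \<in> carrier (grp2 G)"
    by (cases h; cases y) auto
  \<comment> \<open>Only the image of \<open>c\<close> under \<open>w1 g\<close> enters the
    computation. It is read off from \<open>h\<close> times its inverse, so no formula for the
    inverse is needed.\<close>
  define c where "c = fst (inv\<^bsub>strictification1\<^esub> h)"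
  have c [simp]: "c \<in> carrier (grp2 B)"
    using S1.inv_closed [OF h] by (auto simp: c_def mem_Times_iff)
  have inv_h: "snd (inv\<^bsub>strictification1\<^esub> h) = inv\<^bsub>grp1 G\<^esub> g"
    using snd.hom_inv [OF h] by simp
  have "fst (h \<otimes>\<^bsub>strictification1\<^esub> inv\<^bsub>strictification1\<^esub> h) = \<one>\<^bsub>grp2 B\<^esub>"
    by (simp only: S1.r_inv [OF h] strictification1_sel(2) fst_conv)
  then have "a \<otimes>\<^bsub>grp2 B\<^esub> act B (w1 g) c \<otimes>\<^bsub>grp2 B\<^esub> inv\<^bsub>grp2 B\<^esub> (w3 g (inv\<^bsub>grp1 G\<^esub> g)) = \<one>\<^bsub>grp2 B\<^esub>"
    unfolding strictification1_sel(3) inv_h c_def [symmetric] by simp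
  then have act_c: "act B (w1 g) c = inv\<^bsub>grp2 B\<^esub> a \<otimes>\<^bsub>grp2 B\<^esub> w3 g (inv\<^bsub>grp1 G\<^esub> g)"
    by (simp add: B.grp2.inv_solve_left B.grp2.inv_solve_right')
  have "fst (act strictification h y) =
      fst (h \<otimes>\<^bsub>strictification1\<^esub> strictification_bd y \<otimes>\<^bsub>strictification1\<^esub> inv\<^bsub>strictification1\<^esub> h)"
    by (simp only: strictification_bd_act [OF h y, symmetric] strictification_bd_sel)
  also have "\<dots> = a \<otimes>\<^bsub>grp2 B\<^esub> act B (w1 g) b
      \<otimes>\<^bsub>grp2 B\<^esub> inv\<^bsub>grp2 B\<^esub> (w3 g (bd G x)) \<otimes>\<^bsub>grp2 B\<^esub> act B (w1 (g \<otimes>\<^bsub>grp1 G\<^esub> bd G x)) c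
      \<otimes>\<^bsub>grp2 B\<^esub> inv\<^bsub>grp2 B\<^esub> (w3 (g \<otimes>\<^bsub>grp1 G\<^esub> bd G x) (inv\<^bsub>grp1 G\<^esub> g))"
    unfolding strictification1_sel(3,4) inv_h c_def [symmetric] by simp
  \<comment> \<open>After \<open>w2_act\<close> is inserted all \<open>w3\<close> cancel, the last
    of them against the one in \<open>act_c\<close>, which leaves conjugation by
    \<open>a\<close>.\<close>
  finally show "strict2 (act strictification h y) = act B (strict1 h) (strict2 y)"
    by (simp add: strict1_def strict2_def act_w1_mult w2_act B.peiffer B.act_mult B.act_mult_right
        B.act_inv_right act_c B.grp2.m_assoc)
qed

end


section \<open>Equivalences of 2-groups\<close>

lemma two_group_of_sel [simp]:
  "mor1 (two_group_of G) = carrier (grp1 G)"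
  "comp1 (two_group_of G) g h = g \<otimes>\<^bsub>grp1 G\<^esub> h"
  "unit1 (two_group_of G) = \<one>\<^bsub>grp1 G\<^esub>"
  "mor2 (two_group_of G) = carrier (grp2 G) \<times> carrier (grp1 G)"
  "src (two_group_of G) a = snd a"
  "tgt (two_group_of G) a = bd G (fst a) \<otimes>\<^bsub>grp1 G\<^esub> snd a"
  "id2 (two_group_of G) g = (\<one>\<^bsub>grp2 G\<^esub>, g)"
  "vcomp (two_group_of G) b a = (fst b \<otimes>\<^bsub>grp2 G\<^esub> fst a, snd a)"
  "hcomp (two_group_of G) b a = (fst b \<otimes>\<^bsub>grp2 G\<^esub> act G (snd b) (fst a), snd b \<otimes>\<^bsub>grp1 G\<^esub> snd a)"
  by (simp_all add: two_group_of_def case_prod_unfold)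

lemma cell2_two_group_of [simp]:
  "cell2 (two_group_of G) a f g \<longleftrightarrow>
    fst a \<in> carrier (grp2 G) \<and> f \<in> carrier (grp1 G) \<and> snd a = f \<and> bd G (fst a) \<otimes>\<^bsub>grp1 G\<^esub> f = g"
  by (auto simp: cell2_def mem_Times_iff)

lemma induced_hom_sel [simp]:
  "map1 (induced_hom G \<phi>1 \<phi>2) = \<phi>1"
  "map2 (induced_hom G \<phi>1 \<phi>2) a = (\<phi>2 (fst a), \<phi>1 (snd a))"
  "hom_comp (induced_hom G \<phi>1 \<phi>2) h' h = (\<one>\<^bsub>grp2 G\<^esub>, \<phi>1 h' \<otimes>\<^bsub>grp1 G\<^esub> \<phi>1 h)"
  "hom_unit (induced_hom G \<phi>1 \<phi>2) = (\<one>\<^bsub>grp2 G\<^esub>, \<one>\<^bsub>grp1 G\<^esub>)"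
  by (simp_all add: induced_hom_def case_prod_unfold)

lemma comp_two_group_hom_sel [simp]:
  "map1 (comp_two_group_hom Z F E) g = map1 F (map1 E g)"
  "map2 (comp_two_group_hom Z F E) a = map2 F (map2 E a)"
  "hom_comp (comp_two_group_hom Z F E) g' g =
    vcomp Z (map2 F (hom_comp E g' g)) (hom_comp F (map1 E g') (map1 E g))"
  "hom_unit (comp_two_group_hom Z F E) = vcomp Z (map2 F (hom_unit E)) (hom_unit F)"
  by (simp_all add: comp_two_group_hom_def)

lemma id_two_group_hom_sel [simp]:
  "map1 (id_two_group_hom C) g = g"
  "map2 (id_two_group_hom C) a = a"
  "hom_comp (id_two_group_hom C) g' g = id2 C (comp1 C g' g)"
  "hom_unit (id_two_group_hom C) = id2 C (unit1 C)"
  by (simp_all add: id_two_group_hom_def)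

locale crossed_module_hom = H: graded_crossed_module H + G: graded_crossed_module G
  for H :: "('h, 'y) crossed_module" and G :: "('g, 'x) crossed_module" +
  fixes \<phi>1 :: "'h \<Rightarrow> 'g" and \<phi>2 :: "'y \<Rightarrow> 'x"
  assumes strict_hom: "strict_hom H G \<phi>1 \<phi>2"

sublocale crossed_module_hom \<subseteq> \<phi>1: group_hom "grp1 H" "grp1 G" \<phi>1
  using strict_hom by unfold_locales (simp add: strict_hom_def)

sublocale crossed_module_hom \<subseteq> \<phi>2: group_hom "grp2 H" "grp2 G" \<phi>2
  using strict_hom by unfold_locales (simp add: strict_hom_def)

lemma (in crossed_module_hom)
  shows \<phi>1_bd [simp]: "y \<in> carrier (grp2 H) \<Longrightarrow> \<phi>1 (bd H y) = bd G (\<phi>2 y)"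
    and \<phi>2_act [simp]: "\<lbrakk>h \<in> carrier (grp1 H); y \<in> carrier (grp2 H)\<rbrakk> \<Longrightarrow>
      \<phi>2 (act H h y) = act G (\<phi>1 h) (\<phi>2 y)"
    and grading_\<phi>1 [simp]: "h \<in> carrier (grp1 H) \<Longrightarrow> grading G (\<phi>1 h) = grading H h"
  using strict_hom by (auto simp: strict_hom_def)

lemma (in crossed_module_hom) induced_hom_two_group_hom:
  "is_two_group_hom (two_group_of H) (two_group_of G) (induced_hom G \<phi>1 \<phi>2)"
  unfolding is_two_group_hom_def
  by (auto simp: mem_Times_iff G.act_one H.grp1.m_assoc G.grp1.m_assoc G.grp2.m_assoc)

text \<open>
  The hypothesis on lifts says that \<open>grp2 H\<close> is the pullback of \<open>\<phi>1\<close> along \<open>bd G\<close>, i.e. that the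
  induced homomorphism of 2-groups is bijective on 2-morphisms with given source and target.
\<close>

locale crossed_module_pullback = crossed_module_hom H G \<phi>1 \<phi>2
  for H :: "('h, 'y) crossed_module" and G :: "('g, 'x) crossed_module" and \<phi>1 \<phi>2 +
  assumes surj: "\<phi>1 ` carrier (grp1 H) = carrier (grp1 G)"
    and lift_unique: "\<lbrakk>h \<in> carrier (grp1 H); x \<in> carrier (grp2 G); \<phi>1 h = bd G x\<rbrakk> \<Longrightarrow>
      \<exists>!y. y \<in> carrier (grp2 H) \<and> bd H y = h \<and> \<phi>2 y = x"
begin

definition lift :: "'h \<Rightarrow> 'x \<Rightarrow> 'y" where
  "lift h x = (THE y. y \<in> carrier (grp2 H) \<and> bd H y = h \<and> \<phi>2 y = x)"

lemma
  assumes "h \<in> carrier (grp1 H)" "x \<in> carrier (grp2 G)" "\<phi>1 h = bd G x"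
  shows lift_closed [simp]: "lift h x \<in> carrier (grp2 H)"
    and bd_lift [simp]: "bd H (lift h x) = h"
    and \<phi>2_lift [simp]: "\<phi>2 (lift h x) = x"
  using theI' [OF lift_unique [OF assms]] by (simp_all add: lift_def)

text \<open>Uniqueness of lifts, in the form used to compare 2-morphisms of
  \<open>H\<close>.\<close>

lemma grp2_eqI:
  assumes "y \<in> carrier (grp2 H)" "z \<in> carrier (grp2 H)" "bd H y = bd H z" "\<phi>2 y = \<phi>2 z"
  shows "y = z"
  using assms lift_unique [of "bd H z" "\<phi>2 z"] by auto

text \<open>A mere choice of preimages, in general not multiplicative. This is why the inverse below
  is a pseudofunctor with nontrivial structure 2-morphisms.\<close>

definition section_map :: "'g \<Rightarrow> 'h" where
  "section_map = inv_into (carrier (grp1 H)) \<phi>1"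

lemma
  assumes "g \<in> carrier (grp1 G)"
  shows section_map_closed [simp]: "section_map g \<in> carrier (grp1 H)"
    and \<phi>1_section_map [simp]: "\<phi>1 (section_map g) = g"
  using assms by (simp_all add: section_map_def surj inv_into_into f_inv_into_f)

text \<open>The 2-morphism \<open>f \<Rightarrow> g\<close> of \<open>H\<close> over
  \<open>x\<close>: its boundary has to be \<open>g\<close> times the inverse of \<open>f\<close>.
  It is meaningful when \<open>x\<close> goes from the image of \<open>f\<close> to that of
  \<open>g\<close>.\<close>

definition lift_cell :: "'x \<Rightarrow> 'h \<Rightarrow> 'h \<Rightarrow> 'y \<times> 'h" where
  "lift_cell x f g = (lift (g \<otimes>\<^bsub>grp1 H\<^esub> inv\<^bsub>grp1 H\<^esub> f) x, f)"

definition quasi_inverse :: "('g, 'x \<times> 'g, 'h, 'y \<times> 'h) two_group_hom" where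
  "quasi_inverse =
    \<lparr>map1 = section_map,
     map2 = (\<lambda>a. lift_cell (fst a) (section_map (snd a)) (section_map (bd G (fst a) \<otimes>\<^bsub>grp1 G\<^esub> snd a))),
     hom_comp = (\<lambda>g h. lift_cell \<one>\<^bsub>grp2 G\<^esub> (section_map g \<otimes>\<^bsub>grp1 H\<^esub> section_map h) (section_map (g \<otimes>\<^bsub>grp1 G\<^esub> h))),
     hom_unit = lift_cell \<one>\<^bsub>grp2 G\<^esub> \<one>\<^bsub>grp1 H\<^esub> (section_map \<one>\<^bsub>grp1 G\<^esub>)\<rparr>"

lemma quasi_inverse_sel [simp]:
  "map1 quasi_inverse = section_map"
  "map2 quasi_inverse a =
    lift_cell (fst a) (section_map (snd a)) (section_map (bd G (fst a) \<otimes>\<^bsub>grp1 G\<^esub> snd a))"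
  "hom_comp quasi_inverse g h =
    lift_cell \<one>\<^bsub>grp2 G\<^esub> (section_map g \<otimes>\<^bsub>grp1 H\<^esub> section_map h) (section_map (g \<otimes>\<^bsub>grp1 G\<^esub> h))"
  "hom_unit quasi_inverse = lift_cell \<one>\<^bsub>grp2 G\<^esub> \<one>\<^bsub>grp1 H\<^esub> (section_map \<one>\<^bsub>grp1 G\<^esub>)"
  by (simp_all add: quasi_inverse_def)

lemma snd_lift_cell [simp]: "snd (lift_cell x f g) = f"
  by (simp add: lift_cell_def)

lemma
  assumes "f \<in> carrier (grp1 H)" "g \<in> carrier (grp1 H)" "x \<in> carrier (grp2 G)"
    "\<phi>1 g = bd G x \<otimes>\<^bsub>grp1 G\<^esub> \<phi>1 f"
  shows lift_cell_closed [simp]: "fst (lift_cell x f g) \<in> carrier (grp2 H)"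
    and bd_lift_cell [simp]: "bd H (fst (lift_cell x f g)) = g \<otimes>\<^bsub>grp1 H\<^esub> inv\<^bsub>grp1 H\<^esub> f"
    and \<phi>2_lift_cell [simp]: "\<phi>2 (fst (lift_cell x f g)) = x"
proof -
  have "\<phi>1 (g \<otimes>\<^bsub>grp1 H\<^esub> inv\<^bsub>grp1 H\<^esub> f) = bd G x"
    using assms by (simp add: G.grp1.m_assoc)
  then show "fst (lift_cell x f g) \<in> carrier (grp2 H)" "\<phi>2 (fst (lift_cell x f g)) = x"
    "bd H (fst (lift_cell x f g)) = g \<otimes>\<^bsub>grp1 H\<^esub> inv\<^bsub>grp1 H\<^esub> f"
    using assms by (simp_all add: lift_cell_def)
qed

text \<open>The induced homomorphism is faithful on parallel 2-morphisms. Coherence equations in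
  \<open>H\<close> are thus checked on boundaries and on images in \<open>G\<close>, where the
  structure 2-morphisms of \<open>quasi_inverse\<close> become identities.\<close>

lemma cell_eqI:
  assumes "fst a \<in> carrier (grp2 H)" "fst b \<in> carrier (grp2 H)" "snd a = snd b"
    "bd H (fst a) = bd H (fst b)" "\<phi>2 (fst a) = \<phi>2 (fst b)"
  shows "a = b"
  using assms by (simp add: prod_eq_iff grp2_eqI)

lemmas cell_simps = mem_Times_iff H.act_one G.act_one H.equivariance H.grp1.m_assoc G.grp1.m_assoc
  G.grp2.m_assoc H.grp1.inv_mult_group

lemma quasi_inverse_two_group_hom:
  "is_two_group_hom (two_group_of G) (two_group_of H) quasi_inverse"
  unfolding is_two_group_hom_def
  by (intro conjI ballI impI; (intro cell_eqI)?) (simp_all add: cell_simps G.equivariance)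

text \<open>\<open>h\<close> and \<open>section_map (\<phi>1 h)\<close> have the same image in
  \<open>G\<close>; the components are the lifts of the identity between them.\<close>

lemma pseudonat_quasi_inverse_left:
  "pseudonat (two_group_of H) (two_group_of H)
    (comp_two_group_hom (two_group_of H) quasi_inverse (induced_hom G \<phi>1 \<phi>2))
    (id_two_group_hom (two_group_of H)) \<one>\<^bsub>grp1 H\<^esub> (\<lambda>h. lift_cell \<one>\<^bsub>grp2 G\<^esub> h (section_map (\<phi>1 h)))"
  unfolding pseudonat_def
  by (intro conjI ballI; (intro cell_eqI)?) (simp_all add: cell_simps)

text \<open>\<open>section_map\<close> is a section of \<open>\<phi>1\<close>, so the composite
  fixes all 1-morphisms and identities serve as components.\<close>

lemma pseudonat_quasi_inverse_right:
  "pseudonat (two_group_of G) (two_group_of G)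
    (comp_two_group_hom (two_group_of G) (induced_hom G \<phi>1 \<phi>2) quasi_inverse)
    (id_two_group_hom (two_group_of G)) \<one>\<^bsub>grp1 G\<^esub> (\<lambda>g. (\<one>\<^bsub>grp2 G\<^esub>, g))"
  unfolding pseudonat_def
  by (intro conjI ballI) (simp_all add: cell_simps)

theorem induced_hom_equivalence:
  "two_group_equivalence (two_group_of H) (two_group_of G) (induced_hom G \<phi>1 \<phi>2)"
  unfolding two_group_equivalence_def
  using induced_hom_two_group_hom quasi_inverse_two_group_hom
    pseudonat_quasi_inverse_left pseudonat_quasi_inverse_right by blast

end

lemma (in weak_hom) strictification_pullback: "crossed_module_pullback strictification G snd snd"
proof (intro crossed_module_pullback.intro crossed_module_hom.intro
    crossed_module_hom_axioms.intro crossed_module_pullback_axioms.intro)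
  show "graded_crossed_module strictification"
    by (rule strictification_graded_crossed_module)
  show "graded_crossed_module G"
    by (rule G.graded_crossed_module_axioms)
  show "strict_hom strictification G snd snd"
    by (rule strict_hom_snd)
  show "snd ` carrier (grp1 strictification) = carrier (grp1 G)"
    \<comment> \<open>The unit shows that the first factor is nonempty, so the second projection of
      the product is onto.\<close>
    using B.grp2.one_closed by (simp, blast intro: snd_image_times)
  fix h x
  assume "h \<in> carrier (grp1 strictification)" "x \<in> carrier (grp2 G)" "snd h = bd G x"
  then show "\<exists>!y. y \<in> carrier (grp2 strictification) \<and> bd strictification y = h \<and> snd y = x"
    by (intro ex1I [of _ "(fst h, x)"] strictification2_eqI) (auto simp: mem_Times_iff)
qed


section \<open>Invertibility of the regular bimodule\<close>

text \<open>A structure identified with the regular bimodule through \<open>i\<close>. The bimodule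
  laws are inherited from \<open>A\<close> because \<open>i\<close> is injective and compatible with
  all operations.\<close>

locale regular_copy = assoc_algebra K A
  for K :: "'k ring" and A :: "('k, 'a) module" +
  fixes M :: "('k, 'a, 'a, 'm) bimodule" and i :: "'m \<Rightarrow> 'a"
  assumes bij: "bij_betw i (carrier M) (carrier A)"
    and zero: "\<zero>\<^bsub>M\<^esub> \<in> carrier M" "i \<zero>\<^bsub>M\<^esub> = \<zero>\<^bsub>A\<^esub>"
    and add: "\<lbrakk>m \<in> carrier M; n \<in> carrier M\<rbrakk> \<Longrightarrow> m \<oplus>\<^bsub>M\<^esub> n \<in> carrier M"
      "\<lbrakk>m \<in> carrier M; n \<in> carrier M\<rbrakk> \<Longrightarrow> i (m \<oplus>\<^bsub>M\<^esub> n) = i m \<oplus>\<^bsub>A\<^esub> i n"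
    and smult: "\<lbrakk>k \<in> carrier K; m \<in> carrier M\<rbrakk> \<Longrightarrow> k \<odot>\<^bsub>M\<^esub> m \<in> carrier M"
      "\<lbrakk>k \<in> carrier K; m \<in> carrier M\<rbrakk> \<Longrightarrow> i (k \<odot>\<^bsub>M\<^esub> m) = k \<odot>\<^bsub>A\<^esub> i m"
    and lact: "\<lbrakk>b \<in> carrier A; m \<in> carrier M\<rbrakk> \<Longrightarrow> lact M b m \<in> carrier M"
      "\<lbrakk>b \<in> carrier A; m \<in> carrier M\<rbrakk> \<Longrightarrow> i (lact M b m) = b \<otimes>\<^bsub>A\<^esub> i m"
    and ract: "\<lbrakk>m \<in> carrier M; a \<in> carrier A\<rbrakk> \<Longrightarrow> ract M m a \<in> carrier M"
      "\<lbrakk>m \<in> carrier M; a \<in> carrier A\<rbrakk> \<Longrightarrow> i (ract M m a) = i m \<otimes>\<^bsub>A\<^esub> a"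
begin

lemmas [simp] = zero add smult lact ract

lemma i_closed [simp]: "m \<in> carrier M \<Longrightarrow> i m \<in> carrier A"
  using bij by (auto simp: bij_betw_def)

lemma i_eqI: "\<lbrakk>m \<in> carrier M; n \<in> carrier M; i m = i n\<rbrakk> \<Longrightarrow> m = n"
  using bij by (auto simp: bij_betw_def inj_on_def)

definition j :: "'a \<Rightarrow> 'm" where "j = inv_into (carrier M) i"

lemma
  assumes "a \<in> carrier A"
  shows j_closed [simp]: "j a \<in> carrier M" and i_j [simp]: "i (j a) = a"
  using assms bij by (auto simp: j_def bij_betw_def inv_into_into f_inv_into_f)

lemma bimodule: "bimodule K A A M"
proof (intro bimodule.intro bimodule_axioms.intro assoc_algebra_axioms)
  have "abelian_group M"
  proof (rule abelian_groupI)
    fix m assume "m \<in> carrier M"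
    then show "\<exists>n\<in>carrier M. n \<oplus>\<^bsub>M\<^esub> m = \<zero>\<^bsub>M\<^esub>"
      by (intro bexI [of _ "j (\<ominus>\<^bsub>A\<^esub> i m)"] i_eqI) (simp_all add: A.l_neg)
  qed (auto intro!: i_eqI simp: A.a_ac)
  with Mod.R.cring_axioms show "module K M"
    by (rule moduleI)
      (auto intro!: i_eqI simp: Mod.smult_l_distr Mod.smult_r_distr Mod.smult_assoc1)
qed (auto intro!: i_eqI simp: A.l_distr A.r_distr A.m_assoc smult_mult_left smult_mult_right)

end

context assoc_algebra
begin

lemma regular_regular_copy: "regular_copy K A (regular_bimodule A) id"
  by unfold_locales (simp_all add: regular_bimodule_def)

text \<open>
  A copy of the regular bimodule on constant functions, as an inverse of a bimodule with elements
  in \<open>'a\<close> has to have elements in \<open>'a \<Rightarrow> 'a\<close>.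
\<close>

definition constant_bimodule :: "('k, 'a, 'a, 'a \<Rightarrow> 'a) bimodule" where
  "constant_bimodule =
    \<lparr>carrier = (\<lambda>a _. a) ` carrier A, monoid.mult = undefined, one = undefined,
     ring.zero = (\<lambda>_. \<zero>\<^bsub>A\<^esub>), add = (\<lambda>f g x. f x \<oplus>\<^bsub>A\<^esub> g x), smult = (\<lambda>k f x. k \<odot>\<^bsub>A\<^esub> f x),
     lact = (\<lambda>b f x. b \<otimes>\<^bsub>A\<^esub> f x), ract = (\<lambda>f a x. f x \<otimes>\<^bsub>A\<^esub> a)\<rparr>"

text \<open>The functions are constant, so their value can be read off at any point, here
  \<open>undefined\<close>.\<close>

lemma constant_regular_copy: "regular_copy K A constant_bimodule (\<lambda>f. f undefined)"
  by unfold_locales (auto simp: constant_bimodule_def bij_betw_def inj_on_def image_image)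

end

text \<open>Two arbitrary copies of the regular bimodule, so that one computation serves for the
  tensor products in both orders.\<close>

locale regular_copies =
  M: regular_copy K A M i + N: regular_copy K A N j
  for K :: "'k ring" and A :: "('k, 'a) module"
    and M :: "('k, 'a, 'a, 'm) bimodule" and i
    and N :: "('k, 'a, 'a, 'n) bimodule" and j
begin

abbreviation F where "F \<equiv> free_Abelian_group (carrier M \<times> carrier N)"
abbreviation S where "S \<equiv> tensor_subgroup A M N"

lemma diff_closed: "\<lbrakk>x \<in> carrier F; y \<in> carrier F\<rbrakk> \<Longrightarrow> x - y \<in> carrier F"
  using keys_diff [of x y] by auto

lemma tensor_relations_closed: "tensor_relations A M N \<subseteq> carrier F"
  by (auto simp: tensor_relations_def simp del: carrier_free_Abelian_group_iff intro!: diff_closed)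

interpretation F: comm_group F
  by (rule abelian_free_Abelian_group)

lemma S_subgroup: "subgroup S F"
  unfolding tensor_subgroup_def using tensor_relations_closed by (rule F.generate_is_subgroup)

lemma S_closed:
  assumes "x \<in> S" "y \<in> S"
  shows "x + y \<in> S" "x - y \<in> S"
proof -
  interpret subgroup S F by (rule S_subgroup)
  show "x + y \<in> S"
    using m_closed [OF assms] by simp
  have "inv\<^bsub>F\<^esub> y = - y"
    using subsetD [OF subset assms(2)] by simp
  then show "x - y \<in> S"
    using m_closed [OF assms(1) m_inv_closed [OF assms(2)]] by simp
qed

lemma relations_in_S: "x \<in> tensor_relations A M N \<Longrightarrow> x \<in> S"
  by (simp add: tensor_subgroup_def generate.incl)

text \<open>The multiplication map of \<open>A\<close> before passing to the tensor product; the
  universal property of the free abelian group provides it.\<close>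

definition contraction :: "('m \<times> 'n \<Rightarrow>\<^sub>0 int) \<Rightarrow> 'a" where
  "contraction = (SOME h. h \<in> hom F (add_monoid A) \<and>
     (\<forall>m\<in>carrier M. \<forall>n\<in>carrier N. h (frag_of (m, n)) = i m \<otimes>\<^bsub>A\<^esub> j n))"

lemma
  shows contraction_hom: "contraction \<in> hom F (add_monoid A)"
    and contraction_frag_of [simp]: "\<lbrakk>m \<in> carrier M; n \<in> carrier N\<rbrakk> \<Longrightarrow>
      contraction (frag_of (m, n)) = i m \<otimes>\<^bsub>A\<^esub> j n"
proof -
  have *: "(\<lambda>p. i (fst p) \<otimes>\<^bsub>A\<^esub> j (snd p)) ` (carrier M \<times> carrier N) \<subseteq> carrier (add_monoid A)"
    by auto
  obtain h where "h \<in> hom F (add_monoid A)"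
    "\<And>p. p \<in> carrier M \<times> carrier N \<Longrightarrow> h (frag_of p) = i (fst p) \<otimes>\<^bsub>A\<^esub> j (snd p)"
    using comm_group.free_Abelian_group_universal [OF M.A.a_comm_group *] by blast
  then have "\<exists>h. h \<in> hom F (add_monoid A) \<and>
     (\<forall>m\<in>carrier M. \<forall>n\<in>carrier N. h (frag_of (m, n)) = i m \<otimes>\<^bsub>A\<^esub> j n)"
    by (intro exI [of _ h]) auto
  from someI_ex [OF this] show "contraction \<in> hom F (add_monoid A)"
    "\<lbrakk>m \<in> carrier M; n \<in> carrier N\<rbrakk> \<Longrightarrow> contraction (frag_of (m, n)) = i m \<otimes>\<^bsub>A\<^esub> j n"
    unfolding contraction_def by auto
qed

interpretation contraction: group_hom F "add_monoid A" contraction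
  using contraction_hom M.A.a_group by unfold_locales (auto simp: group.axioms)

lemma contraction_closed [simp]: "x \<in> carrier F \<Longrightarrow> contraction x \<in> carrier A"
  using contraction.hom_closed [of x] by simp

lemma contraction_diff:
  assumes "x \<in> carrier F" "y \<in> carrier F"
  shows "contraction (x - y) = contraction x \<ominus>\<^bsub>A\<^esub> contraction y"
  using assms contraction.hom_mult [of x "- y"] contraction.hom_inv [of y]
  by (simp_all add: a_minus_def a_inv_def)

text \<open>Let \<open>e\<close> correspond to 1. The balancing relation moves all of
  \<open>m\<close> across to the second entry, turning \<open>(m, n)\<close> into a generator with
  first entry \<open>e\<close>; additivity in the second entry then merges such generators into
  one.\<close>

lemma normal_form:
  assumes "z \<in> carrier F"
  shows "z - frag_of (M.j \<one>\<^bsub>A\<^esub>, N.j (contraction z)) \<in> S"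
proof -
  have rel2: "frag_of (m, n \<oplus>\<^bsub>N\<^esub> n') - frag_of (m, n) - frag_of (m, n') \<in> S"
    if "m \<in> carrier M" "n \<in> carrier N" "n' \<in> carrier N" for m n n'
    using that by (intro relations_in_S) (unfold tensor_relations_def, blast)
  have rel3: "frag_of (ract M m a, n) - frag_of (m, lact N a n) \<in> S"
    if "m \<in> carrier M" "a \<in> carrier A" "n \<in> carrier N" for m a n
    using that by (intro relations_in_S) (unfold tensor_relations_def, blast)
  define e where "e = M.j \<one>\<^bsub>A\<^esub>"
  have e [simp]: "e \<in> carrier M" "i e = \<one>\<^bsub>A\<^esub>"
    by (simp_all add: e_def)
  have zero: "contraction 0 = \<zero>\<^bsub>A\<^esub>"
    using contraction.hom_one by simp
  \<comment> \<open>Membership in \<open>F\<close> is carried through the induction, as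
    \<open>contraction_diff\<close> requires it of both terms.\<close>
  have "z \<in> carrier F \<and> z - frag_of (e, N.j (contraction z)) \<in> S"
    using assms unfolding carrier_free_Abelian_group_iff
  proof (induction z rule: frag_induction)
    case zero
    \<comment> \<open>The relation for 0 + 0 = 0 reduces to minus the generator with entries
      \<open>e\<close> and 0, which is the difference to be shown in \<open>S\<close>.\<close>
    have "N.j \<zero>\<^bsub>A\<^esub> \<oplus>\<^bsub>N\<^esub> N.j \<zero>\<^bsub>A\<^esub> = N.j \<zero>\<^bsub>A\<^esub>"
      by (intro N.i_eqI) simp_all
    then show ?case
      using rel2 [of e "N.j \<zero>\<^bsub>A\<^esub>" "N.j \<zero>\<^bsub>A\<^esub>"] by (simp add: \<open>contraction 0 = _\<close>)
  next
    case (one p)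
    then obtain m n where p: "p = (m, n)" and m: "m \<in> carrier M" and n: "n \<in> carrier N"
      by auto
    have "ract M e (i m) = m"
      using m by (intro M.i_eqI) simp_all
    moreover have "lact N (i m) n = N.j (i m \<otimes>\<^bsub>A\<^esub> j n)"
      using m n by (intro N.i_eqI) simp_all
    ultimately show ?case
      using rel3 [of e "i m" n] m n by (simp add: p)
  next
    case (diff a b)
    then have ab [simp]: "a \<in> carrier F" "b \<in> carrier F"
      by simp_all
    \<comment> \<open>The induction produces differences while the relations concern sums; hence
      \<open>contraction a\<close> is written as the sum of the difference and
      \<open>contraction b\<close>.\<close>
    let ?u = "N.j (contraction a \<ominus>\<^bsub>A\<^esub> contraction b)" and ?v = "N.j (contraction b)"
    have "?u \<oplus>\<^bsub>N\<^esub> ?v = N.j (contraction a)"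
      by (intro N.i_eqI) (simp_all add: M.A.minus_eq M.A.a_assoc M.A.l_neg del: carrier_free_Abelian_group_iff)
    then have "frag_of (e, N.j (contraction a)) - frag_of (e, ?u) - frag_of (e, ?v) \<in> S"
      using rel2 [of e ?u ?v] by (simp del: carrier_free_Abelian_group_iff)
    with diff have "(a - frag_of (e, N.j (contraction a))) - (b - frag_of (e, ?v))
        + (frag_of (e, N.j (contraction a)) - frag_of (e, ?u) - frag_of (e, ?v)) \<in> S"
      using S_closed by meson
    moreover have "a - b \<in> carrier F"
      using ab by (rule diff_closed)
    ultimately show ?case
      by (simp add: contraction_diff algebra_simps flip: carrier_free_Abelian_group_iff)
  qed
  then show ?thesis
    by (simp add: e_def)
qed

text \<open>The relations are killed by distributivity and associativity in \<open>A\<close>.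
  Conversely, an element of the kernel has the same normal form as 0, so it lies in
  \<open>S\<close>.\<close>

lemma kernel_contraction: "kernel F (add_monoid A) contraction = S"
proof
  have cancel: "(a \<oplus>\<^bsub>A\<^esub> b) \<ominus>\<^bsub>A\<^esub> a \<ominus>\<^bsub>A\<^esub> b = \<zero>\<^bsub>A\<^esub>" if "a \<in> carrier A" "b \<in> carrier A" for a b
    using that M.A.r_neg [of "a \<oplus>\<^bsub>A\<^esub> b"] by (simp add: M.A.minus_eq M.A.minus_add M.A.a_assoc)
  have "tensor_relations A M N \<subseteq> kernel F (add_monoid A) contraction"
  proof
    fix x assume x: "x \<in> tensor_relations A M N"
    then have "contraction x = \<zero>\<^bsub>A\<^esub>"
      unfolding tensor_relations_def
      by (auto simp: contraction_diff diff_closed M.A.l_distr M.A.r_distr M.A.m_assoc cancel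
          simp del: carrier_free_Abelian_group_iff)
    with x tensor_relations_closed show "x \<in> kernel F (add_monoid A) contraction"
      by (auto simp: kernel_def simp del: carrier_free_Abelian_group_iff)
  qed
  then show "S \<subseteq> kernel F (add_monoid A) contraction"
    unfolding tensor_subgroup_def
    by (rule F.generate_subgroup_incl) (rule contraction.subgroup_kernel)
next
  show "kernel F (add_monoid A) contraction \<subseteq> S"
  proof
    fix z assume "z \<in> kernel F (add_monoid A) contraction"
    then have z: "z \<in> carrier F" and "contraction z = contraction 0"
      using contraction.hom_one by (auto simp: kernel_def)
    moreover have "0 \<in> carrier F"
      by simp
    ultimately have "(z - frag_of (M.j \<one>\<^bsub>A\<^esub>, N.j (contraction z))) -
        (0 - frag_of (M.j \<one>\<^bsub>A\<^esub>, N.j (contraction z))) \<in> S"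
      using normal_form S_closed(2) by metis
    then show "z \<in> S"
      by simp
  qed
qed

text \<open>For \<open>a\<close> in \<open>A\<close> these turn out to be the cosets of
  \<open>S\<close>, so the tensor product becomes indexed by \<open>A\<close>.\<close>

definition fibre :: "'a \<Rightarrow> ('m \<times> 'n \<Rightarrow>\<^sub>0 int) set" where
  "fibre a = {z \<in> carrier F. contraction z = a}"

lemma contraction_surj:
  assumes "a \<in> carrier A"
  obtains z where "z \<in> carrier F" "contraction z = a"
  using assms by (intro that [of "frag_of (M.j \<one>\<^bsub>A\<^esub>, N.j a)"]) simp_all

lemma coset_eq_fibre:
  assumes z: "z \<in> carrier F"
  shows "S #>\<^bsub>F\<^esub> z = fibre (contraction z)"
proof
  show "S #>\<^bsub>F\<^esub> z \<subseteq> fibre (contraction z)"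
    using z contraction.hom_mult [of _ z] subgroup.subset [OF S_subgroup]
    by (auto simp: fibre_def r_coset_def kernel_def simp flip: kernel_contraction
        simp del: carrier_free_Abelian_group_iff mult_free_Abelian_group)
next
  show "fibre (contraction z) \<subseteq> S #>\<^bsub>F\<^esub> z"
  proof
    fix u assume "u \<in> fibre (contraction z)"
    then have u: "u \<in> carrier F" and "contraction u = contraction z"
      by (auto simp: fibre_def simp del: carrier_free_Abelian_group_iff)
    then have "u - z \<in> S"
      using z by (auto simp: kernel_def contraction_diff diff_closed M.A.minus_eq M.A.r_neg
          simp flip: kernel_contraction simp del: carrier_free_Abelian_group_iff)
    then show "u \<in> S #>\<^bsub>F\<^esub> z"
      by (force simp: r_coset_def)
  qed
qed

section \<open>Identification of the tensor product with the regular bimodule\<close>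

lemma carrier_tensor_group: "carrier (tensor_group A M N) = fibre ` carrier A"
proof -
  have "carrier (tensor_group A M N) = (\<lambda>z. fibre (contraction z)) ` carrier F"
    by (simp add: tensor_group_def FactGroup_def RCOSETS_def coset_eq_fibre image_def
        del: carrier_free_Abelian_group_iff)
      (auto simp: coset_eq_fibre simp del: carrier_free_Abelian_group_iff)
  also have "\<dots> = fibre ` carrier A"
    by (auto simp del: carrier_free_Abelian_group_iff intro: contraction_closed
        elim!: contraction_surj intro!: imageI image_eqI)
  finally show ?thesis .
qed

text \<open>\<open>contraction\<close> is constant on each coset; with \<open>the_elem\<close> this
  is the isomorphism that \<open>FactGroup_iso_set\<close> supplies.\<close>

definition tensor_iso :: "('m \<times> 'n \<Rightarrow>\<^sub>0 int) set \<Rightarrow> 'a" where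
  "tensor_iso T = the_elem (contraction ` T)"

lemma tensor_iso_fibre [simp]:
  assumes "a \<in> carrier A"
  shows "tensor_iso (fibre a) = a"
proof -
  obtain z where "z \<in> fibre a"
    using assms by (auto simp: fibre_def elim!: contraction_surj simp del: carrier_free_Abelian_group_iff)
  then have "contraction ` fibre a = {a}"
    by (auto simp: fibre_def)
  then show ?thesis
    by (simp add: tensor_iso_def)
qed

lemma tensor_iso_iso: "tensor_iso \<in> iso (tensor_group A M N) (add_monoid A)"
proof -
  have "contraction ` carrier F = carrier (add_monoid A)"
    using contraction.hom_closed by (auto elim!: contraction_surj simp del: carrier_free_Abelian_group_iff)
  from contraction.FactGroup_iso_set [OF this] show ?thesis
    by (simp add: kernel_contraction tensor_group_def tensor_iso_def [abs_def])
qed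

text \<open>Covers all three actions on the tensor product at once: on generators \<open>f\<close>
  lies over the additive map \<open>c\<close>, and additivity extends this to all of
  \<open>F\<close>.\<close>

lemma tensor_map_fibre:
  assumes a: "a \<in> carrier A"
    and f: "\<And>m n. \<lbrakk>m \<in> carrier M; n \<in> carrier N\<rbrakk> \<Longrightarrow> f (m, n) \<in> carrier M \<times> carrier N"
    and c: "c \<in> hom (add_monoid A) (add_monoid A)"
    and fc: "\<And>m n. \<lbrakk>m \<in> carrier M; n \<in> carrier N\<rbrakk> \<Longrightarrow>
      i (fst (f (m, n))) \<otimes>\<^bsub>A\<^esub> j (snd (f (m, n))) = c (i m \<otimes>\<^bsub>A\<^esub> j n)"
  shows "tensor_map A M N f (fibre a) = fibre (c a)"
proof -
  interpret c: group_hom "add_monoid A" "add_monoid A" c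
    using c M.A.a_group by unfold_locales (auto simp: group.axioms)
  let ?f = "frag_extend (\<lambda>p. frag_of (f p))"
  have *: "z \<in> carrier F \<and> ?f z \<in> carrier F \<and> contraction (?f z) = c (contraction z)"
    if "z \<in> carrier F" for z
    using that unfolding carrier_free_Abelian_group_iff
  proof (induction z rule: frag_induction)
    case zero
    then show ?case
      using contraction.hom_one c.hom_one by simp
  next
    case (one p)
    then obtain m n where "p = (m, n)" "m \<in> carrier M" "n \<in> carrier N"
      by auto
    moreover from this f [of m n] fc [of m n] obtain m' n' where
      "f (m, n) = (m', n')" "m' \<in> carrier M" "n' \<in> carrier N" "i m' \<otimes>\<^bsub>A\<^esub> j n' = c (i m \<otimes>\<^bsub>A\<^esub> j n)"
      by auto
    ultimately show ?case
      by simp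
  next
    case (diff a b)
    then have "a \<in> carrier F" "b \<in> carrier F" "?f a \<in> carrier F" "?f b \<in> carrier F"
      by simp_all
    with diff c.hom_mult [of "contraction a" "\<ominus>\<^bsub>A\<^esub> contraction b"] c.hom_inv [of "contraction b"]
    show ?case
      unfolding carrier_free_Abelian_group_iff [symmetric]
      by (simp add: frag_extend_diff contraction_diff diff_closed M.A.minus_eq a_inv_def [symmetric]
          del: carrier_free_Abelian_group_iff)
  qed
  \<comment> \<open>A union of equal sets is that set only over a nonempty index set.\<close>
  obtain z where "z \<in> fibre a"
    using a by (auto simp: fibre_def elim!: contraction_surj simp del: carrier_free_Abelian_group_iff)
  have "tensor_map A M N f (fibre a) = (\<Union>z\<in>fibre a. fibre (contraction (?f z)))"
    unfolding tensor_map_def by (intro SUP_cong refl coset_eq_fibre) (use * in \<open>simp add: fibre_def\<close>)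
  also have "\<dots> = (\<Union>z\<in>fibre a. fibre (c a))"
    using * by (intro SUP_cong refl) (simp add: fibre_def)
  also have "\<dots> = fibre (c a)"
    using \<open>z \<in> fibre a\<close> by auto
  finally show ?thesis .
qed

lemma
  assumes "a \<in> carrier A"
  shows tensor_smult: "k \<in> carrier K \<Longrightarrow> k \<odot>\<^bsub>tensor_bimodule A M N\<^esub> fibre a = fibre (k \<odot>\<^bsub>A\<^esub> a)"
    and tensor_lact: "b \<in> carrier A \<Longrightarrow> lact (tensor_bimodule A M N) b (fibre a) = fibre (b \<otimes>\<^bsub>A\<^esub> a)"
    and tensor_ract: "b \<in> carrier A \<Longrightarrow> ract (tensor_bimodule A M N) (fibre a) b = fibre (a \<otimes>\<^bsub>A\<^esub> b)"
  unfolding tensor_bimodule_def using assms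
  by (simp_all, (intro tensor_map_fibre;
      auto simp: hom_def M.A.l_distr M.A.r_distr M.A.m_assoc M.Mod.smult_r_distr M.smult_mult_left)+)

lemma tensor_iso_bimodule_iso:
  "tensor_iso \<in> bimodule_iso K A A (tensor_bimodule A M N) (regular_bimodule A)"
  unfolding bimodule_iso_def linear_iso_def
proof (intro CollectI conjI ballI)
  have [simp]: "carrier (tensor_bimodule A M N) = carrier (tensor_group A M N)"
    by (simp add: tensor_bimodule_def)
  show "bij_betw tensor_iso (carrier (tensor_bimodule A M N)) (carrier (regular_bimodule A))"
    using tensor_iso_iso by (simp add: iso_def regular_bimodule_def)
  show "tensor_iso (T \<oplus>\<^bsub>tensor_bimodule A M N\<^esub> U) = tensor_iso T \<oplus>\<^bsub>regular_bimodule A\<^esub> tensor_iso U"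
    if "T \<in> carrier (tensor_bimodule A M N)" "U \<in> carrier (tensor_bimodule A M N)" for T U
    using that tensor_iso_iso by (simp add: iso_def hom_def tensor_bimodule_def regular_bimodule_def)
  show "tensor_iso (k \<odot>\<^bsub>tensor_bimodule A M N\<^esub> T) = k \<odot>\<^bsub>regular_bimodule A\<^esub> tensor_iso T"
    if "k \<in> carrier K" "T \<in> carrier (tensor_bimodule A M N)" for k T
    using that by (auto simp: carrier_tensor_group tensor_smult regular_bimodule_def)
  show "tensor_iso (lact (tensor_bimodule A M N) b (ract (tensor_bimodule A M N) T a)) =
      lact (regular_bimodule A) b (ract (regular_bimodule A) (tensor_iso T) a)"
    if "b \<in> carrier A" "T \<in> carrier (tensor_bimodule A M N)" "a \<in> carrier A" for b T a
    using that by (auto simp: carrier_tensor_group tensor_lact tensor_ract regular_bimodule_def)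
qed

end

theorem (in assoc_algebra) regular_bimodule_invertible:
  "invertible_bimodule K A A (regular_bimodule A)"
  unfolding invertible_bimodule_def
proof (intro conjI exI [of _ constant_bimodule])
  show "bimodule K A A (regular_bimodule A)" "bimodule K A A constant_bimodule"
    using regular_copy.bimodule regular_regular_copy constant_regular_copy by blast+
  have "regular_copies K A (regular_bimodule A) id constant_bimodule (\<lambda>f. f undefined)"
    "regular_copies K A constant_bimodule (\<lambda>f. f undefined) (regular_bimodule A) id"
    by (intro regular_copies.intro regular_regular_copy constant_regular_copy)+
  then show
    "bimodule_iso K A A (tensor_bimodule A (regular_bimodule A) constant_bimodule) (regular_bimodule A) \<noteq> {}"
    "bimodule_iso K A A (tensor_bimodule A constant_bimodule (regular_bimodule A)) (regular_bimodule A) \<noteq> {}"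
    using regular_copies.tensor_iso_bimodule_iso by blast+
qed


section \<open>Morita equivalence with the strictification\<close>

lemma (in N_weak_algebra) weak_hom: "weak_hom G (AUT_gen K A) (om1 w) (om2 w) (om3 w)"
proof (intro weak_hom.intro weak_hom_axioms.intro graded_crossed_module_axioms
    AUT_gen_graded_crossed_module)
  fix g x assume "g \<in> carrier (grp1 G)" "x \<in> carrier (grp2 G)"
  then show "om2 w (act G g x) =
      om3 w (g \<otimes>\<^bsub>grp1 G\<^esub> bd G x) (inv\<^bsub>grp1 G\<^esub> g) \<otimes>\<^bsub>grp2 (AUT_gen K A)\<^esub> om3 w g (bd G x)
        \<otimes>\<^bsub>grp2 (AUT_gen K A)\<^esub> act (AUT_gen K A) (om1 w g) (om2 w x)
        \<otimes>\<^bsub>grp2 (AUT_gen K A)\<^esub> inv\<^bsub>grp2 (AUT_gen K A)\<^esub> (om3 w g (inv\<^bsub>grp1 G\<^esub> g))"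
    by (simp only: om2_act AUT_gen_sel(3) AUT_gen_inv om3_closed grp1.inv_closed)
qed (simp_all only: om1_closed om1_degree om1_one om2_closed om2_one om3_closed om3_one_left
    om3_one_right om1_mult om2_mult om1_bd om3_cocycle AUT_gen_sel(1-4))

sublocale N_weak_algebra \<subseteq> om: weak_hom G "AUT_gen K A" "om1 w" "om2 w" "om3 w"
  by (rule weak_hom)

lemma pullback_action_sel [simp]:
  "om1 (pullback_action w \<phi>1 \<phi>2) h = om1 w (\<phi>1 h)"
  "om2 (pullback_action w \<phi>1 \<phi>2) y = om2 w (\<phi>2 y)"
  "om3 (pullback_action w \<phi>1 \<phi>2) h k = om3 w (\<phi>1 h) (\<phi>1 k)"
  by (simp_all add: pullback_action_def)

lemma strict_action_sel [simp]:
  "om1 (strict_action A \<psi>1 \<psi>2) = \<psi>1"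
  "om2 (strict_action A \<psi>1 \<psi>2) = \<psi>2"
  "om3 (strict_action A \<psi>1 \<psi>2) h k = \<one>\<^bsub>A\<^esub>"
  by (simp_all add: strict_action_def)

theorem (in N_weak_algebra) N_weak_algebra_pullback:
  assumes "crossed_module_hom H G \<phi>1 \<phi>2"
  shows "N_weak_algebra K H A (pullback_action w \<phi>1 \<phi>2)"
proof -
  interpret crossed_module_hom H G \<phi>1 \<phi>2 by fact
  show ?thesis
    by (intro N_weak_algebra.intro N_weak_algebra_axioms.intro H.graded_crossed_module_axioms
        assoc_algebra_axioms)
      (simp_all only: pullback_action_sel \<phi>1.hom_closed \<phi>1.hom_one \<phi>1.hom_mult \<phi>1.hom_inv
        \<phi>2.hom_closed \<phi>2.hom_one \<phi>2.hom_mult \<phi>1_bd \<phi>2_act grading_\<phi>1 H.bd.hom_closed om1_closed om1_degree om1_one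
        om2_closed om2_one om3_closed om3_one_left om3_one_right om1_mult om2_mult om1_bd
        om3_cocycle om2_act)
qed

theorem (in assoc_algebra) N_weak_algebra_strict:
  assumes "crossed_module_hom H (AUT_gen K A) \<psi>1 \<psi>2"
  shows "N_weak_algebra K H A (strict_action A \<psi>1 \<psi>2)"
proof -
  interpret \<psi>: crossed_module_hom H "AUT_gen K A" \<psi>1 \<psi>2 by fact
  have \<psi>1: "\<psi>1 h \<in> carrier (Aut_gen K A)" if "h \<in> carrier (grp1 H)" for h
    using \<psi>.\<phi>1.hom_closed [OF that] by simp
  have \<psi>2: "\<psi>2 y \<in> Units A" if "y \<in> carrier (grp2 H)" for y
    using \<psi>.\<phi>2.hom_closed [OF that] by simp
  have one: "bd (AUT_gen K A) \<one>\<^bsub>A\<^esub> = \<one>\<^bsub>Aut_gen K A\<^esub>"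
    using \<psi>.G.bd.hom_one by (simp only: AUT_gen_sel)
  have act_one: "act (AUT_gen K A) (\<psi>1 h) \<one>\<^bsub>A\<^esub> = \<one>\<^bsub>A\<^esub>" if "h \<in> carrier (grp1 H)" for h
    using \<psi>1 [OF that] by simp
  have act_closed: "act (AUT_gen K A) (\<psi>1 h) u \<in> carrier A" if "h \<in> carrier (grp1 H)" "u \<in> Units A" for h u
    using \<psi>1 that by simp
  interpret Aut: group "Aut_gen K A" by (rule Aut_gen_group)
  show ?thesis
    using \<psi>.\<phi>1.hom_mult \<psi>.\<phi>1.hom_one \<psi>.\<phi>2.hom_mult \<psi>.\<phi>2.hom_one \<psi>.\<phi>2_act \<psi>.\<phi>1_bd \<psi>.grading_\<phi>1
    by (intro N_weak_algebra.intro N_weak_algebra_axioms.intro \<psi>.H.graded_crossed_module_axioms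
        assoc_algebra_axioms)
      (simp_all del: AUT_gen_sel(6,7) add: \<psi>1 \<psi>2 one act_one act_closed)
qed

section \<open>The dual of the regular bimodule\<close>

context assoc_algebra
begin

lemma regular_bimodule_sel [simp]:
  "carrier (regular_bimodule A) = carrier A"
  "add (regular_bimodule A) = add A"
  "smult (regular_bimodule A) = smult A"
  "lact (regular_bimodule A) = monoid.mult A"
  "ract (regular_bimodule A) = monoid.mult A"
  by (simp_all add: regular_bimodule_def)

abbreviation regular_dual :: "('k, 'a, 'a, 'a \<Rightarrow> 'a) bimodule" where
  "regular_dual \<equiv> dual_bimodule A A (regular_bimodule A)"

lemma regular_dual_sel [simp]:
  "m \<in> carrier A \<Longrightarrow> (f \<oplus>\<^bsub>regular_dual\<^esub> f') m = f m \<oplus>\<^bsub>A\<^esub> f' m"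
  "m \<in> carrier A \<Longrightarrow> (k \<odot>\<^bsub>regular_dual\<^esub> f) m = k \<odot>\<^bsub>A\<^esub> f m"
  "m \<in> carrier A \<Longrightarrow> lact regular_dual b f m = f (b \<otimes>\<^bsub>A\<^esub> m)"
  "m \<in> carrier A \<Longrightarrow> ract regular_dual f a m = a \<otimes>\<^bsub>A\<^esub> f m"
  by (simp_all add: dual_bimodule_def)

text \<open>Right linearity applied to 1 times \<open>m\<close>: elements of the dual are left
  multiplications.\<close>

lemma regular_dual_apply:
  assumes "f \<in> carrier regular_dual" "m \<in> carrier A"
  shows "f m = f \<one>\<^bsub>A\<^esub> \<otimes>\<^bsub>A\<^esub> m"
proof -
  \<comment> \<open>\<open>A.l_one\<close> is switched off so that the product with 1 does not
    collapse before linearity is applied.\<close>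
  have "f (\<one>\<^bsub>A\<^esub> \<otimes>\<^bsub>A\<^esub> m) = f \<one>\<^bsub>A\<^esub> \<otimes>\<^bsub>A\<^esub> m"
    using assms A.one_closed unfolding dual_bimodule_def regular_bimodule_def
    by (simp del: A.l_one)
  with assms show ?thesis by simp
qed

text \<open>The inverse sends \<open>b\<close> to left multiplication by \<open>b\<close>. Through
  this identification the intertwiners of both degrees are given by one formula.\<close>

lemma regular_dual_eval_bij: "bij_betw (\<lambda>f. f \<one>\<^bsub>A\<^esub>) (carrier regular_dual) (carrier A)"
proof (rule bij_betw_byWitness [where f' = "\<lambda>b. \<lambda>m\<in>carrier A. b \<otimes>\<^bsub>A\<^esub> m"])
  show "\<forall>f\<in>carrier regular_dual. (\<lambda>m\<in>carrier A. f \<one>\<^bsub>A\<^esub> \<otimes>\<^bsub>A\<^esub> m) = f"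
  proof (intro ballI extensionalityI [where A = "carrier A"])
    fix f assume f: "f \<in> carrier regular_dual"
    then show "f \<in> extensional (carrier A)"
      by (auto simp: dual_bimodule_def regular_bimodule_def PiE_def)
    show "(\<lambda>m\<in>carrier A. f \<one>\<^bsub>A\<^esub> \<otimes>\<^bsub>A\<^esub> m) x = f x" if "x \<in> carrier A" for x
      using regular_dual_apply [OF f that] that by simp
  qed simp
qed (auto simp: dual_bimodule_def regular_bimodule_def A.r_distr A.m_assoc)

lemma regular_dual_closed [simp]:
  "f \<in> carrier regular_dual \<Longrightarrow> m \<in> carrier A \<Longrightarrow> f m \<in> carrier A"
  by (auto simp: dual_bimodule_def regular_bimodule_def)

end

section \<open>The intertwiners and their composition laws\<close>

context N_weak_algebra
begin

lemma om1_in_Aut_gen [simp]: "g \<in> carrier (grp1 G) \<Longrightarrow> om1 w g \<in> carrier (Aut_gen K A)"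
  by (rule om1_closed)

lemma om3_Units [simp]:
  "\<lbrakk>g \<in> carrier (grp1 G); h \<in> carrier (grp1 G)\<rbrakk> \<Longrightarrow> om3 w g h \<in> Units A"
  by (rule om3_closed)

lemma om2_Units [simp]: "x \<in> carrier (grp2 G) \<Longrightarrow> om2 w x \<in> Units A"
  by (rule om2_closed)

lemma fst_om1 [simp]: "g \<in> carrier (grp1 G) \<Longrightarrow> fst (om1 w g) = grading G g"
  using om1_degree by simp

lemma om1_mult_apply:
  assumes "g \<in> carrier (grp1 G)" "h \<in> carrier (grp1 G)" "m \<in> carrier A"
  shows "snd (om1 w (g \<otimes>\<^bsub>grp1 G\<^esub> h)) m =
    om3 w g h \<otimes>\<^bsub>A\<^esub> snd (om1 w g) (snd (om1 w h) m) \<otimes>\<^bsub>A\<^esub> inv\<^bsub>A\<^esub> (om3 w g h)"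
  using assms by (simp add: om1_mult)

lemma om1_bd_apply:
  assumes "x \<in> carrier (grp2 G)" "m \<in> carrier A"
  shows "snd (om1 w (bd G x)) m = om2 w x \<otimes>\<^bsub>A\<^esub> m \<otimes>\<^bsub>A\<^esub> inv\<^bsub>A\<^esub> (om2 w x)"
  using assms om1_bd by simp

lemma carrier_strictification:
  "h \<in> carrier om.strictification1 \<longleftrightarrow> fst h \<in> Units A \<and> snd h \<in> carrier (grp1 G)"
  by (simp add: mem_Times_iff)

lemma fst_strictification_mult:
  assumes "h \<in> carrier om.strictification1" "k \<in> carrier om.strictification1"
  shows "fst (h \<otimes>\<^bsub>om.strictification1\<^esub> k) =
    fst h \<otimes>\<^bsub>A\<^esub> snd (om1 w (snd h)) (if grading G (snd h) = 1 then fst k else inv\<^bsub>A\<^esub> (fst k))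
      \<otimes>\<^bsub>A\<^esub> inv\<^bsub>A\<^esub> (om3 w (snd h) (snd k))"
  using assms unfolding carrier_strictification by (simp add: AUT_gen_inv)

lemma strict1_apply:
  assumes "h \<in> carrier om.strictification1" "m \<in> carrier A"
  shows "snd (om.strict1 h) m = fst h \<otimes>\<^bsub>A\<^esub> snd (om1 w (snd h)) m \<otimes>\<^bsub>A\<^esub> inv\<^bsub>A\<^esub> (fst h)"
  using assms unfolding carrier_strictification by (simp add: om.strict1_def)

definition intertwiner_pos :: "'a \<times> 'g \<Rightarrow> 'a \<Rightarrow> 'a" where
  "intertwiner_pos h m = fst h \<otimes>\<^bsub>A\<^esub> snd (om1 w (snd h)) m"

definition intertwiner_neg :: "'a \<times> 'g \<Rightarrow> ('a \<Rightarrow> 'a) \<Rightarrow> 'a" where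
  "intertwiner_neg h f = intertwiner_pos h (f \<one>\<^bsub>A\<^esub>)"

lemma intertwiner_pos_bij:
  assumes "h \<in> carrier om.strictification1"
  shows "bij_betw (intertwiner_pos h) (carrier A) (carrier A)"
proof -
  from assms have h: "fst h \<in> Units A" "snd h \<in> carrier (grp1 G)"
    by (simp_all only: carrier_strictification)
  then have "bij_betw ((\<otimes>\<^bsub>A\<^esub>) (fst h)) (carrier A) (carrier A)"
    by (intro bij_betw_byWitness [where f' = "(\<otimes>\<^bsub>A\<^esub>) (inv\<^bsub>A\<^esub> (fst h))"]) auto
  with Aut_gen_bij [OF om1_closed [OF h(2)]]
  have "bij_betw ((\<otimes>\<^bsub>A\<^esub>) (fst h) \<circ> snd (om1 w (snd h))) (carrier A) (carrier A)"
    by (rule bij_betw_trans)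
  then show ?thesis
    by (simp add: intertwiner_pos_def [abs_def] comp_def)
qed

text \<open>If \<open>h\<close> has degree -1, the action inverts \<open>fst k\<close> and
  antimultiplicativity moves it to the right of \<open>m\<close>. The resulting argument is what the
  transported dual elements take as value at 1.\<close>

lemma intertwiner_pos_mult:
  assumes "h \<in> carrier om.strictification1" "k \<in> carrier om.strictification1" "m \<in> carrier A"
  shows "intertwiner_pos (h \<otimes>\<^bsub>om.strictification1\<^esub> k) m =
    fst h \<otimes>\<^bsub>A\<^esub> snd (om1 w (snd h)) (if grading G (snd h) = 1 then intertwiner_pos k m
      else snd (om1 w (snd k)) m \<otimes>\<^bsub>A\<^esub> inv\<^bsub>A\<^esub> (fst k)) \<otimes>\<^bsub>A\<^esub> inv\<^bsub>A\<^esub> (om3 w (snd h) (snd k))"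
  using assms(3) assms(1,2) [unfolded carrier_strictification]
  unfolding intertwiner_pos_def fst_strictification_mult [OF assms(1,2)]
  by (auto simp: om1_mult_apply Aut_gen_mult A.m_assoc)

text \<open>Evaluating \<open>dual_transport\<close> at 1 calls for the preimage of 1 under an
  intertwiner; this computes what \<open>om1\<close> makes of it.\<close>

lemma intertwiner_pos_eq_one:
  assumes "h \<in> carrier om.strictification1" "m \<in> carrier A" "intertwiner_pos h m = \<one>\<^bsub>A\<^esub>"
  shows "snd (om1 w (snd h)) m = inv\<^bsub>A\<^esub> (fst h)"
proof -
  from assms(1) have h: "fst h \<in> Units A" "snd h \<in> carrier (grp1 G)"
    by (simp_all only: carrier_strictification)
  then have "snd (om1 w (snd h)) m = inv\<^bsub>A\<^esub> (fst h) \<otimes>\<^bsub>A\<^esub> intertwiner_pos h m"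
    using assms(2) by (simp add: intertwiner_pos_def)
  with h assms(3) show ?thesis
    by simp
qed

lemma intertwiner_neg_bij:
  assumes "h \<in> carrier om.strictification1"
  shows "bij_betw (intertwiner_neg h) (carrier regular_dual) (carrier A)"
  using bij_betw_trans [OF regular_dual_eval_bij intertwiner_pos_bij [OF assms]]
  by (simp add: intertwiner_neg_def [abs_def] comp_def)

theorem strictification_morphism:
  "N_weak_morphism K om.strictification A (pullback_action w snd snd)
    A (strict_action A om.strict1 om.strict2) (regular_bimodule A) intertwiner_pos intertwiner_neg"
proof (intro N_weak_morphism.intro N_weak_morphism_axioms.intro)
  have hom: "crossed_module_hom om.strictification G snd snd"
    using om.strictification_pullback by (rule crossed_module_pullback.axioms)
  then show "N_weak_algebra K om.strictification A (pullback_action w snd snd)"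
    by (rule N_weak_algebra_pullback)
  have "crossed_module_hom om.strictification (AUT_gen K A) om.strict1 om.strict2"
    by (intro crossed_module_hom.intro crossed_module_hom_axioms.intro om.strict_hom_strict
        om.strictification_graded_crossed_module AUT_gen_graded_crossed_module)
  then show "N_weak_algebra K om.strictification A (strict_action A om.strict1 om.strict2)"
    by (rule N_weak_algebra_strict)
  show "bimodule K A A (regular_bimodule A)"
    using regular_regular_copy by (rule regular_copy.bimodule)
next
  fix m assume "m \<in> carrier (regular_bimodule A)"
  then show "intertwiner_pos \<one>\<^bsub>grp1 om.strictification\<^esub> m = m"
    by (simp add: intertwiner_pos_def om1_one)
next
  fix h assume "h \<in> carrier (grp1 om.strictification)"
  then have h: "h \<in> carrier om.strictification1" by simp
  then have [simp]: "fst h \<in> Units A" "snd h \<in> carrier (grp1 G)"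
    by (simp_all only: carrier_strictification)
  show "intertwiner_pos h \<in> linear_iso K (regular_bimodule A) (regular_bimodule A)"
    unfolding linear_iso_def using intertwiner_pos_bij [OF h]
    by (simp add: intertwiner_pos_def Aut_gen_add Aut_gen_smult A.r_distr smult_mult_right)
  show "intertwiner_neg h \<in> linear_iso K regular_dual (regular_bimodule A)"
    unfolding linear_iso_def using intertwiner_neg_bij [OF h]
    by (simp add: intertwiner_neg_def intertwiner_pos_def Aut_gen_add Aut_gen_smult A.r_distr smult_mult_right)
  fix b a assume ba: "b \<in> carrier A" "a \<in> carrier A"
  show "intertwiner_pos h (lact (regular_bimodule A) b (ract (regular_bimodule A) m a)) =
      lact (regular_bimodule A) (snd (om1 (strict_action A om.strict1 om.strict2) h) b)
        (ract (regular_bimodule A) (intertwiner_pos h m) (snd (om1 (pullback_action w snd snd) h) a))"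
    if "grading om.strictification h = 1" "m \<in> carrier (regular_bimodule A)" for m
    using that ba by (simp add: intertwiner_pos_def strict1_apply [OF h] Aut_gen_mult A.m_assoc)
  show "intertwiner_neg h (lact regular_dual b (ract regular_dual f a)) =
      lact (regular_bimodule A) (snd (om1 (strict_action A om.strict1 om.strict2) h) b)
        (ract (regular_bimodule A) (intertwiner_neg h f) (snd (om1 (pullback_action w snd snd) h) a))"
    if "grading om.strictification h = -1" "f \<in> carrier regular_dual" for f
    using that ba regular_dual_apply [OF that(2) ba(1)]
    by (simp add: intertwiner_neg_def intertwiner_pos_def strict1_apply [OF h] Aut_gen_mult A.m_assoc)
next
  fix h k assume "h \<in> carrier (grp1 om.strictification)" "k \<in> carrier (grp1 om.strictification)"
  then have h: "h \<in> carrier om.strictification1" and k: "k \<in> carrier om.strictification1" by simp_all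
  then have [simp]: "fst h \<in> Units A" "snd h \<in> carrier (grp1 G)"
    "fst k \<in> Units A" "snd k \<in> carrier (grp1 G)"
    by (simp_all only: carrier_strictification)
  \<comment> \<open>Common form of the four composition laws. It remains to recognize
    \<open>m'\<close>: the value of the inner intertwiner if \<open>h\<close> has degree 1, the
    value at 1 of the transported dual element otherwise.\<close>
  have mult: "intertwiner_pos (h \<otimes>\<^bsub>grp1 om.strictification\<^esub> k) m =
      lact (regular_bimodule A) (om3 (strict_action A om.strict1 om.strict2) h k)
        (ract (regular_bimodule A) (intertwiner_pos h m')
          (inv\<^bsub>A\<^esub> (om3 (pullback_action w snd snd) h k)))"
    if "m \<in> carrier A" "m' \<in> carrier A" "m' = (if grading G (snd h) = 1 then intertwiner_pos k m
      else snd (om1 w (snd k)) m \<otimes>\<^bsub>A\<^esub> inv\<^bsub>A\<^esub> (fst k))" for m m'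
    using that(1,2) intertwiner_pos_mult [OF h k that(1)]
    unfolding that(3) [symmetric] by (simp add: intertwiner_pos_def)
  have pos_closed: "intertwiner_pos k m \<in> carrier A" if "m \<in> carrier A" for m
    using that by (simp add: intertwiner_pos_def)
  show "intertwiner_pos (h \<otimes>\<^bsub>grp1 om.strictification\<^esub> k) m =
      lact (regular_bimodule A) (om3 (strict_action A om.strict1 om.strict2) h k)
        (ract (regular_bimodule A) (intertwiner_pos h (intertwiner_pos k m))
          (inv\<^bsub>A\<^esub> (om3 (pullback_action w snd snd) h k)))"
    if "grading om.strictification h = 1" "m \<in> carrier (regular_bimodule A)" for m
    using that pos_closed by (intro mult) simp_all
  show "intertwiner_neg (h \<otimes>\<^bsub>grp1 om.strictification\<^esub> k) f =
      lact (regular_bimodule A) (om3 (strict_action A om.strict1 om.strict2) h k)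
        (ract (regular_bimodule A) (intertwiner_pos h (intertwiner_neg k f))
          (inv\<^bsub>A\<^esub> (om3 (pullback_action w snd snd) h k)))"
    if "grading om.strictification h = 1" "f \<in> carrier regular_dual" for f
    unfolding intertwiner_neg_def using that pos_closed by (intro mult) simp_all
  show "intertwiner_neg (h \<otimes>\<^bsub>grp1 om.strictification\<^esub> k) f =
      lact (regular_bimodule A) (om3 (strict_action A om.strict1 om.strict2) h k)
        (ract (regular_bimodule A)
          (intertwiner_neg h (dual_transport (snd (om1 (pullback_action w snd snd) k))
            (regular_bimodule A) (regular_bimodule A) (intertwiner_pos k) f))
          (inv\<^bsub>A\<^esub> (om3 (pullback_action w snd snd) h k)))"
    if "grading om.strictification h = -1" "grading om.strictification k = 1"
      "f \<in> carrier regular_dual" for f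
  proof -
    \<comment> \<open>The transported element takes at 1 the value of \<open>om1\<close> at
      \<open>f n\<close>, which is \<open>f\<close> at 1 times \<open>n\<close>. As \<open>k\<close>
      has degree 1, this splits in the same order, and \<open>n\<close> contributes the inverse of
      \<open>fst k\<close>.\<close>
    define n where "n = inv_into (carrier A) (intertwiner_pos k) \<one>\<^bsub>A\<^esub>"
    have n: "n \<in> carrier A" "intertwiner_pos k n = \<one>\<^bsub>A\<^esub>"
      using intertwiner_pos_bij [OF k]
      by (auto simp: n_def bij_betw_def inv_into_into f_inv_into_f)
    show ?thesis
      unfolding intertwiner_neg_def
      using that n regular_dual_apply [OF that(3) n(1)] intertwiner_pos_eq_one [OF k n]
      by (intro mult) (simp_all add: dual_transport_def Aut_gen_mult flip: n_def)
  qed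
  show "intertwiner_pos (h \<otimes>\<^bsub>grp1 om.strictification\<^esub> k) m =
      lact (regular_bimodule A) (om3 (strict_action A om.strict1 om.strict2) h k)
        (ract (regular_bimodule A)
          (intertwiner_neg h (dual_transport (snd (om1 (pullback_action w snd snd) k))
            regular_dual (regular_bimodule A) (intertwiner_neg k) (ev A A (regular_bimodule A) m)))
          (inv\<^bsub>A\<^esub> (om3 (pullback_action w snd snd) h k)))"
    if "grading om.strictification h = -1" "grading om.strictification k = -1"
      "m \<in> carrier (regular_bimodule A)" for m
  proof -
    \<comment> \<open>Evaluation at \<open>m\<close> sends \<open>f\<close> to its value at 1 times
      \<open>m\<close>. As \<open>k\<close> has degree -1, \<open>om1\<close> reverses this product,
      so the inverse of \<open>fst k\<close> again ends up on the right.\<close>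
    define f where "f = inv_into (carrier regular_dual) (intertwiner_neg k) \<one>\<^bsub>A\<^esub>"
    have f: "f \<in> carrier regular_dual" "intertwiner_pos k (f \<one>\<^bsub>A\<^esub>) = \<one>\<^bsub>A\<^esub>"
      using intertwiner_neg_bij [OF k] unfolding intertwiner_neg_def [symmetric]
      by (auto simp: f_def bij_betw_def inv_into_into f_inv_into_f)
    have m: "m \<in> carrier A" using that(3) by simp
    show ?thesis
      unfolding intertwiner_neg_def [of h]
      using that f regular_dual_apply [OF f(1) m] intertwiner_pos_eq_one [OF k _ f(2)]
      by (intro mult) (simp_all add: dual_transport_def ev_def Aut_gen_mult flip: f_def)
  qed
next
  fix y m assume "y \<in> carrier (grp2 om.strictification)" "m \<in> carrier (regular_bimodule A)"
  then show "intertwiner_pos (bd om.strictification y) m =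
      lact (regular_bimodule A) (om2 (strict_action A om.strict1 om.strict2) y)
        (ract (regular_bimodule A) m (inv\<^bsub>A\<^esub> (om2 (pullback_action w snd snd) y)))"
    \<comment> \<open>\<open>om1\<close> of a boundary is conjugation by \<open>om2\<close>: its
      left factor joins \<open>fst y\<close> to form \<open>om.strict2 y\<close>, its right factor
      is the right action.\<close>
    by (auto simp: intertwiner_pos_def om.strict2_def om1_bd_apply A.m_assoc simp del: om.w1_bd)
qed

end

theorem proposition3p2:
  fixes K :: "'k ring"
    and G :: "('g, 'x) crossed_module"
    and A :: "('k, 'a) module"
    and w :: "('g, 'x, 'a) weak_action"
  assumes "field K"
    and "graded_crossed_module G"
    and "N_weak_algebra K G A w"
  shows "\<exists>(H :: ('a \<times> 'g, 'a \<times> 'x) crossed_module) \<phi>1 \<phi>2 \<psi>1 \<psi>2.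
    graded_crossed_module H \<and>
    strict_hom H G \<phi>1 \<phi>2 \<and>
    strict_hom H (AUT_gen K A) \<psi>1 \<psi>2 \<and>
    two_group_equivalence (two_group_of H) (two_group_of G) (induced_hom G \<phi>1 \<phi>2) \<and>
    Morita_equivalent TYPE('a) K H A (pullback_action w \<phi>1 \<phi>2) A (strict_action A \<psi>1 \<psi>2)"
proof -
  interpret N_weak_algebra K G A w by fact
  have "two_group_equivalence (two_group_of om.strictification) (two_group_of G)
      (induced_hom G snd snd)"
    using om.strictification_pullback by (rule crossed_module_pullback.induced_hom_equivalence)
  moreover have "Morita_equivalent TYPE('a) K om.strictification A (pullback_action w snd snd)
      A (strict_action A om.strict1 om.strict2)"
    unfolding Morita_equivalent_def
    using strictification_morphism regular_bimodule_invertible by blast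
  ultimately show ?thesis
    using om.strictification_graded_crossed_module om.strict_hom_snd om.strict_hom_strict by blast
qed

end
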